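(* Let $\mathcal H$ be a real Hilbert space, let $g,h:\mathcal H\to(-\infty,\infty]$ be proper, lower semicontinuous and convex, with $h$ continuous, and let $f:=g-h$ be lower semicontinuous. Assume that $\operatorname{dom}h=\mathcal H$, that $h$ is bounded on bounded subsets of $\mathcal H$, that $\inf_{u\in\mathcal H}f(u)>-\infty$, and that either $g$ or $h$ is strongly convex. Assume moreover: (A1) $f|_{\operatorname{dom}f}$ is locally Lipschitz with respect to $\operatorname{dom}f$, and $f$ has the Polyak-Łojasiewicz property; and at least one of (A2) $g$ is of class $\mathcal C^{1,1}$; (A3) $h$ is of class $\mathcal C^{1,1}$. Let $\theta\in[0,1)$, and let $\{\varepsilon_k\},\{u^k\},\{v^k\},\{w^k\}$ be sequences generated by the following variant of Algorithm I-ADCA (described in the context), where $w^k$ is not a critical point of $\inf_{\mathcal H}f$ for each $k$: if (A2) is the assumption used, then in Step 2 one picks $v^k\in\partial_{\varepsilon_k^{1/\theta}}h(w^k)$; if (A3) is the assumption used, then in Step 3 one picks $u^{k+1}$ as an $\varepsilon_k^{1/\theta}$-solution of the subproblem. Assume that $\{u^k\}$ is bounded, that (A4) any subsequence of $\{u^k\}$ has a strongly convergent subsequence, and the set $\Omega$ of strong cluster points of $\{u^k\}$ is compact, and let $\bar f$ be the constant value of $f$ on $\Omega$ (with $f(u^k)\searrow\bar f$). Let $C,\varepsilon>0$ be such that $\theta$, $C$, $\varepsilon$ are the constants of the uniform Polyak-Łojasiewicz estimate around $\Omega$: whenever $\operatorname{dist}(u;\Omega)\le\varepsilon$, $$|f(u)-\bar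 f|^\theta\le C\|v\|\quad\text{for all }v\in\partial_M(-f)(u)\ \text{ in the case of (A2)},$$ $$|f(u)-\bar f|^\theta\le C\|v\|\quad\text{for all }v\in\partial_M f(u)\ \text{ in the case of (A3)}.$$ Then: (i) When $\theta=0$, the sequence $\{f(u^k)\}$ converges to $\bar f$ in a finite number of steps. (ii) When $\theta\in(0,1/2]$, the sequence $\{f(u^k)\}$ converges linearly to $\bar f$. (iii) When $\theta\in(1/2,1)$, there exists $\eta>0$ such that $$f(u^k)-\bar f\le\eta\,k^{\frac{1}{1-2\theta}}\quad\text{for all sufficiently large }k\in\mathbb N.$$
   Context: For a convex function $\varphi$ on $\mathcal H$, $\sigma_\varphi$ denotes its modulus of strong convexity: the supremum of all $\sigma\ge0$ such that $\varphi(\lambda x+(1-\lambda)y)\le\lambda\varphi(x)+(1-\lambda)\varphi(y)-\frac{\sigma}{2}\lambda(1-\lambda)\|x-y\|^2$ for all $x,y\in\mathcal H$, $\lambda\in[0,1]$; $\varphi$ is strongly convex if $\sigma_\varphi>0$. For $\varepsilon\ge 0$ and $u\in\operatorname{dom}\varphi$, $\partial_\varepsilon\varphi(u):=\{v\in\mathcal H:\langle v,u'-u\rangle\le\varphi(u')-\varphi(u)+\varepsilon\ \ \forall u'\in\mathcal H\}$, and $\partial\varphi:=\partial_0\varphi$ is the convex subdifferential. A point $u$ is a critical point of $\inf_{\mathcal H}(g-h)$ if $\partial g(u)\cap\partial h(u)\ne\varnothing$. A point $u_\varepsilon$ is an $\varepsilon$-solution of $\inf_{u\in\mathcal H}\varphi(u)$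 if $\varphi(u_\varepsilon)\le\inf_{\mathcal H}\varphi+\varepsilon$. Algorithm I-ADCA. Initialization: $u^0\in\operatorname{dom}f$, a reduction factor $\gamma\in(0,1)$, $\varepsilon_0\in(0,1]$, $k=0$. Repeat: Step 1: choose $w^k\in\mathcal H$ with $f(w^k)\le f(u^k)$. Step 2: choose $v^k\in\partial_{\varepsilon_k}h(w^k)$. Step 3: choose an $\varepsilon_k$-solution $u^{k+1}$ of $\inf_{u\in\mathcal H}[g(u)-\langle v^k,u\rangle]$. Step 4: while $\varepsilon_k>\frac{\sigma_g+\sigma_h}{32}\|u^{k+1}-w^k\|^2$, set $\varepsilon_k\gets\gamma\varepsilon_k$ and restart from Step 2 with the new $\varepsilon_k$. Step 5: choose $\varepsilon_{k+1}\in(0,\varepsilon_k]$ and set $k\gets k+1$. In the generated sequences, $\varepsilon_k$, $v^k$, $u^{k+1}$ denote the final values on exit from Step 4, so that $0<\varepsilon_k\le\frac{\sigma_g+\sigma_h}{32}\|u^{k+1}-w^k\|^2$ for every $k$. In the variant, only the indicated step is changed (when $\theta=0$, $\varepsilon_k^{1/\theta}$ is read as $0$, i.e. the step is exact). For a proper $f:\mathcal H\to(-\infty,\infty]$ (more generally an extended-real-valued $f$) and $\overline u\in\operatorname{dom}f$, the regular (Fréchet) subdifferential is $\partial_Ff(\overline u):=\{v\in\mathcal H:\liminf_{u\to\overline u}\frac{f(u)-f(\overline u)-\langle v,u-\overline u\rangle}{\|u-\overline u\|}\ge0\}$, and the limiting (Mordukhovich) subdifferential $\partial_Mf(\overline u)$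 is the set of $\overline v\in\mathcal H$ for which there exist $u_k\to\overline u$ with $f(u_k)\to f(\overline u)$ and $v_k\in\partial_Ff(u_k)$ with $v_k\rightharpoonup\overline v$ weakly. Both are empty outside $\operatorname{dom}f$. A point $\overline u$ is $M$-stationary for $f$ if $0\in\partial_Mf(\overline u)$. Polyak-Łojasiewicz property of a proper $f:\mathcal H\to(-\infty,\infty]$: (a) $f|_{\operatorname{dom}f}$ is continuous on $\operatorname{dom}f$; (b) for each $M$-stationary point $\overline u$ of $f$ there exist $C>0$, $\varepsilon>0$, $\theta\in[0,1)$ such that $|f(u)-f(\overline u)|^\theta\le C\|v\|$ for all $u$ in the open ball $B(\overline u,\varepsilon)$ and all $v\in\partial_Mf(u)$. Convention throughout: $0^0:=0$. Class $\mathcal C^{1,1}$: continuously differentiable with Lipschitzian gradient. A strong cluster point of a sequence is a limit of a norm-convergent subsequence; $\operatorname{dist}(u;\Omega)=\inf_{v\in\Omega}\|u-v\|$. "Converges in a finite number of steps" means $f(u^k)=\bar f$ for all large $k$; "converges linearly" means there is $q\in(0,1)$ with $f(u^{k+1})-\bar f\le q\,(f(u^k)-\bar f)$ for all large $k$. *)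

theory Defs
  imports "HOL-Analysis.Analysis"
begin

text \<open>A real Hilbert space is a type of sort \<open>{real_inner, complete_space}\<close>. Functions with values
  in \<open>(-\<infinity>, \<infinity>]\<close> have type \<open>'a \<Rightarrow> ereal\<close>. Note that \<open>0 * \<infinity> = 0\<close> in \<^typ>\<open>ereal\<close>, so the convexity
  inequalities below are harmless at the endpoints \<open>t = 0\<close> and \<open>t = 1\<close>.\<close>

definition edom :: "('a \<Rightarrow> ereal) \<Rightarrow> 'a set" where
  "edom \<phi> = {u. \<phi> u < \<infinity>}"

definition proper_fun :: "('a \<Rightarrow> ereal) \<Rightarrow> bool" where
  "proper_fun \<phi> \<longleftrightarrow> (\<forall>u. \<phi> u \<noteq> -\<infinity>) \<and> edom \<phi> \<noteq> {}"

definition lsc_fun :: "('a::topological_space \<Rightarrow> ereal) \<Rightarrow> bool" where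
  "lsc_fun \<phi> \<longleftrightarrow> (\<forall>u. \<phi> u \<le> Liminf (at u) \<phi>)"

definition convex_fun :: "('a::real_vector \<Rightarrow> ereal) \<Rightarrow> bool" where
  "convex_fun \<phi> \<longleftrightarrow> (\<forall>x y. \<forall>t\<in>{0..1::real}.
     \<phi> (t *\<^sub>R x + (1 - t) *\<^sub>R y) \<le> ereal t * \<phi> x + ereal (1 - t) * \<phi> y)"

text \<open>The modulus is extended-real: for a proper function it is \<open>\<infinity>\<close> exactly when the domain
  is a single point.\<close>

definition strong_convexity_modulus :: "('a::real_normed_vector \<Rightarrow> ereal) \<Rightarrow> ereal" where
  "strong_convexity_modulus \<phi> = Sup (ereal ` {\<sigma>. \<sigma> \<ge> 0 \<and> (\<forall>x y. \<forall>t\<in>{0..1::real}.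
     \<phi> (t *\<^sub>R x + (1 - t) *\<^sub>R y)
       \<le> ereal t * \<phi> x + ereal (1 - t) * \<phi> y - ereal (\<sigma> / 2 * t * (1 - t) * (norm (x - y))\<^sup>2))})"

definition strongly_convex_fun :: "('a::real_normed_vector \<Rightarrow> ereal) \<Rightarrow> bool" where
  "strongly_convex_fun \<phi> \<longleftrightarrow> strong_convexity_modulus \<phi> > 0"

definition eps_subdiff :: "real \<Rightarrow> ('a::real_inner \<Rightarrow> ereal) \<Rightarrow> 'a \<Rightarrow> 'a set" where
  "eps_subdiff e \<phi> u =
     {v. u \<in> edom \<phi> \<and> (\<forall>u'. ereal (inner v (u' - u)) \<le> \<phi> u' - \<phi> u + ereal e)}"

abbreviation convex_subdiff :: "('a::real_inner \<Rightarrow> ereal) \<Rightarrow> 'a \<Rightarrow> 'a set" where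
  "convex_subdiff \<equiv> eps_subdiff 0"

definition critical_point :: "('a::real_inner \<Rightarrow> ereal) \<Rightarrow> ('a \<Rightarrow> ereal) \<Rightarrow> 'a \<Rightarrow> bool" where
  "critical_point g h u \<longleftrightarrow> convex_subdiff g u \<inter> convex_subdiff h u \<noteq> {}"

definition eps_solution :: "real \<Rightarrow> ('a \<Rightarrow> ereal) \<Rightarrow> 'a \<Rightarrow> bool" where
  "eps_solution e \<phi> u \<longleftrightarrow> \<phi> u \<le> (INF u'. \<phi> u') + ereal e"

text \<open>The nonconvex subdifferentials are also applied to functions that may take the value
  \<open>-\<infinity>\<close>; they are empty at every point where the function is not finite.\<close>

definition frechet_subdiff :: "('a::real_inner \<Rightarrow> ereal) \<Rightarrow> 'a \<Rightarrow> 'a set" where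
  "frechet_subdiff \<phi> u = {v. \<bar>\<phi> u\<bar> \<noteq> \<infinity> \<and>
     Liminf (at u) (\<lambda>x. (\<phi> x - \<phi> u - ereal (inner v (x - u))) / ereal (norm (x - u))) \<ge> 0}"

definition weakly_converges :: "(nat \<Rightarrow> 'a::real_inner) \<Rightarrow> 'a \<Rightarrow> bool" where
  "weakly_converges v l \<longleftrightarrow> (\<forall>y. (\<lambda>k. inner (v k) y) \<longlonglongrightarrow> inner l y)"

definition limiting_subdiff :: "('a::real_inner \<Rightarrow> ereal) \<Rightarrow> 'a \<Rightarrow> 'a set" where
  "limiting_subdiff \<phi> u = {v. \<bar>\<phi> u\<bar> \<noteq> \<infinity> \<and>
     (\<exists>us vs. us \<longlonglongrightarrow> u \<and> (\<lambda>k. \<phi> (us k)) \<longlonglongrightarrow> \<phi> u \<and>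
        (\<forall>k. vs k \<in> frechet_subdiff \<phi> (us k)) \<and> weakly_converges vs v)}"

definition M_stationary :: "('a::real_inner \<Rightarrow> ereal) \<Rightarrow> 'a \<Rightarrow> bool" where
  "M_stationary \<phi> u \<longleftrightarrow> 0 \<in> limiting_subdiff \<phi> u"

text \<open>The convention \<open>0\<^sup>0 = 0\<close> is the one of \<^const>\<open>powr\<close>: \<open>0 powr 0 = 0\<close>, and \<open>x powr 0 = 1\<close> for
  \<open>x \<noteq> 0\<close>. The values of the function are finite wherever \<^const>\<open>limiting_subdiff\<close> is nonempty.\<close>

definition PL_property :: "('a::real_inner \<Rightarrow> ereal) \<Rightarrow> bool" where
  "PL_property \<phi> \<longleftrightarrow> continuous_on (edom \<phi>) \<phi> \<and>
     (\<forall>z. M_stationary \<phi> z \<longrightarrow>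
       (\<exists>C>0. \<exists>e>0. \<exists>\<theta>\<in>{0..<1::real}. \<forall>u\<in>ball z e. \<forall>v\<in>limiting_subdiff \<phi> u.
          \<bar>real_of_ereal (\<phi> u) - real_of_ereal (\<phi> z)\<bar> powr \<theta> \<le> C * norm v))"

definition locally_lipschitz_wrt_dom :: "('a::metric_space \<Rightarrow> ereal) \<Rightarrow> bool" where
  "locally_lipschitz_wrt_dom \<phi> \<longleftrightarrow> (\<forall>z\<in>edom \<phi>. \<exists>r>0. \<exists>L.
     L-lipschitz_on (ball z r \<inter> edom \<phi>) (\<lambda>u. real_of_ereal (\<phi> u)))"

text \<open>The Lipschitz condition on the gradient is global and implies its continuity.\<close>

definition C11_fun :: "('a::real_inner \<Rightarrow> ereal) \<Rightarrow> bool" where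
  "C11_fun \<phi> \<longleftrightarrow> (\<forall>u. \<bar>\<phi> u\<bar> \<noteq> \<infinity>) \<and>
     (\<exists>G L. (\<forall>u. GDERIV (\<lambda>x. real_of_ereal (\<phi> x)) u :> G u) \<and> L-lipschitz_on UNIV G)"

definition strong_cluster_points :: "(nat \<Rightarrow> 'a::topological_space) \<Rightarrow> 'a set" where
  "strong_cluster_points u = {l. \<exists>r. strict_mono r \<and> (u \<circ> r) \<longlonglongrightarrow> l}"

text \<open>The functions \<open>a\<close> and \<open>b\<close> give the tolerances of the subgradient step and of the subproblem in
  terms of the current \<open>\<epsilon>\<close>; the basic algorithm is \<open>a = b = id\<close>.\<close>

definition adca_trial ::
  "(real \<Rightarrow> real) \<Rightarrow> (real \<Rightarrow> real) \<Rightarrow> ('a::real_inner \<Rightarrow> ereal) \<Rightarrow> ('a \<Rightarrow> ereal)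
    \<Rightarrow> 'a \<Rightarrow> real \<Rightarrow> 'a \<Rightarrow> 'a \<Rightarrow> bool" where
  "adca_trial a b g h w e v u \<longleftrightarrow>
     v \<in> eps_subdiff (a e) h w \<and> eps_solution (b e) (\<lambda>x. g x - ereal (inner v x)) u"

definition adca_bound :: "('a::real_inner \<Rightarrow> ereal) \<Rightarrow> ('a \<Rightarrow> ereal) \<Rightarrow> 'a \<Rightarrow> 'a \<Rightarrow> ereal" where
  "adca_bound g h w u =
     (strong_convexity_modulus g + strong_convexity_modulus h) / 32 * ereal ((norm (u - w))\<^sup>2)"

text \<open>\<open>adca_inner a b g h \<gamma> w e e' v u\<close>: Steps 2 to 4, entered at the point \<open>w\<close> with the value \<open>e\<close>,
  can terminate with the final values \<open>e'\<close>, \<open>v\<close>, \<open>u\<close> of \<open>\<epsilon>\<^sub>k\<close>, \<open>v\<^sup>k\<close>, \<open>u\<^sup>k\<^sup>+\<^sup>1\<close>.\<close>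

inductive adca_inner ::
  "(real \<Rightarrow> real) \<Rightarrow> (real \<Rightarrow> real) \<Rightarrow> ('a::real_inner \<Rightarrow> ereal) \<Rightarrow> ('a \<Rightarrow> ereal)
    \<Rightarrow> real \<Rightarrow> 'a \<Rightarrow> real \<Rightarrow> real \<Rightarrow> 'a \<Rightarrow> 'a \<Rightarrow> bool"
  for a b g h \<gamma> w where
  exit: "adca_inner a b g h \<gamma> w e e v u"
    if "adca_trial a b g h w e v u" "ereal e \<le> adca_bound g h w u"
| restart: "adca_inner a b g h \<gamma> w e e' v' u'"
    if "adca_trial a b g h w e v u" "ereal e > adca_bound g h w u"
       "adca_inner a b g h \<gamma> w (\<gamma> * e) e' v' u'"

text \<open>Here \<open>\<epsilon> k\<close> is the final value of \<open>\<epsilon>\<^sub>k\<close>, and \<open>e k\<close> the value with which iteration \<open>k\<close> starts.\<close>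

definition adca_generated ::
  "(real \<Rightarrow> real) \<Rightarrow> (real \<Rightarrow> real) \<Rightarrow> ('a::real_inner \<Rightarrow> ereal) \<Rightarrow> ('a \<Rightarrow> ereal)
    \<Rightarrow> (nat \<Rightarrow> real) \<Rightarrow> (nat \<Rightarrow> 'a) \<Rightarrow> (nat \<Rightarrow> 'a) \<Rightarrow> (nat \<Rightarrow> 'a) \<Rightarrow> bool" where
  "adca_generated a b g h \<epsilon> u v w \<longleftrightarrow>
     u 0 \<in> edom (\<lambda>x. g x - h x) \<and>
     (\<exists>\<gamma>\<in>{0<..<1::real}. \<exists>e. e 0 \<in> {0<..1} \<and>
       (\<forall>k. g (w k) - h (w k) \<le> g (u k) - h (u k) \<and>
            adca_inner a b g h \<gamma> (w k) (e k) (\<epsilon> k) (v k) (u (Suc k)) \<and>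
            e (Suc k) \<in> {0<..\<epsilon> k}))"

definition tightened :: "real \<Rightarrow> real \<Rightarrow> real" where
  "tightened \<theta> e = (if \<theta> = 0 then 0 else e powr (1 / \<theta>))"

definition uniform_PL_estimate ::
  "('a::real_inner \<Rightarrow> ereal) \<Rightarrow> ('a \<Rightarrow> 'a set) \<Rightarrow> 'a set \<Rightarrow> real \<Rightarrow> real \<Rightarrow> real \<Rightarrow> real \<Rightarrow> bool" where
  "uniform_PL_estimate f D \<Omega> fbar \<theta> C r \<longleftrightarrow>
     (\<forall>u. infdist u \<Omega> \<le> r \<longrightarrow>
       (\<forall>v\<in>D u. \<bar>real_of_ereal (f u) - fbar\<bar> powr \<theta> \<le> C * norm v))"

end

theory Submission
  imports Defs
begin

text \<open>With \<open>d\<^sub>k = \<parallel>u\<^sup>k\<^sup>+\<^sup>1 - w\<^sup>k\<parallel>\<close>, strong convexity and the exit test of Step 4 give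
  \<open>f(u\<^sup>k\<^sup>+\<^sup>1) + (\<sigma>/8) d\<^sub>k\<^sup>2 \<le> f(w\<^sup>k) \<le> f(u\<^sup>k)\<close>. The function that is not assumed smooth is treated with
  the tightened tolerance \<open>\<delta> = \<epsilon>\<^sub>k\<^sup>1\<^sup>/\<^sup>\<theta>\<close>: a proximal step turns \<open>v\<^sup>k\<close> into an exact subgradient at a
  point within \<open>\<surd>(2\<delta>)\<close>, while \<open>v\<^sup>k\<close> is within \<open>O(\<surd>\<epsilon>\<^sub>k) = O(d\<^sub>k)\<close> of the gradient of the smooth one. So
  \<open>\<plusminus>f\<close> has a limiting subgradient of norm \<open>O(d\<^sub>k)\<close> nearby. Moving back to the iterate changes \<open>f\<close> by
  \<open>O(\<surd>\<delta>)\<close>, whose \<open>\<theta>\<close>-th power is again \<open>O(\<surd>\<epsilon>\<^sub>k) = O(d\<^sub>k)\<close>; this is what the exponent \<open>1/\<theta>\<close> is for.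
  Hence \<open>a\<^sub>k = f(u\<^sup>k) - fbar\<close> satisfies \<open>a\<^sub>k\<^sub>+\<^sub>1\<^sup>2\<^sup>\<theta> \<le> M (a\<^sub>k - a\<^sub>k\<^sub>+\<^sub>1)\<close> eventually, which yields the rates.\<close>

section \<open>Strong convexity and approximate subgradients\<close>

lemma strong_convexity_modulus_nonneg:
  assumes "convex_fun \<phi>"
  shows "0 \<le> strong_convexity_modulus \<phi>"
proof -
  have "0 \<in> ereal ` {\<sigma>. \<sigma> \<ge> 0 \<and> (\<forall>x y. \<forall>t\<in>{0..1::real}.
     \<phi> (t *\<^sub>R x + (1 - t) *\<^sub>R y)
       \<le> ereal t * \<phi> x + ereal (1 - t) * \<phi> y - ereal (\<sigma> / 2 * t * (1 - t) * (norm (x - y))\<^sup>2))}"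
    using assms by (force simp: convex_fun_def zero_ereal_def)
  then show ?thesis
    unfolding strong_convexity_modulus_def by (rule Sup_upper)
qed

text \<open>An admissible \<open>s\<close> is tested at the midpoint of \<open>x\<close> and
  \<open>y\<close>, where the subgradient inequality at \<open>x\<close> bounds
  \<open>\<phi>\<close> from below. A weight \<open>t\<close> on \<open>y\<close> turns the error
  into \<open>\<delta> / t\<close>, so \<open>t\<close> cannot tend to 0 as it would for exact
  subgradients; \<open>t = 1/2\<close> accounts for the factor 4 and the term
  \<open>2 * \<delta>\<close>.\<close>

lemma strong_convexity_modulus_le:
  assumes \<phi>: "proper_fun \<phi>" and v: "v \<in> eps_subdiff \<delta> \<phi> x" and y: "y \<in> edom \<phi>" and "x \<noteq> y"
  shows "strong_convexity_modulus \<phi> \<le> ereal (4 * (real_of_ereal (\<phi> y) - real_of_ereal (\<phi> x)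
            - inner v (y - x) + 2 * \<delta>) / (norm (y - x))\<^sup>2)"
  unfolding strong_convexity_modulus_def
proof (rule Sup_least, clarify)
  fix s :: real
  assume s: "\<forall>x y. \<forall>t\<in>{0..1::real}. \<phi> (t *\<^sub>R x + (1 - t) *\<^sub>R y)
       \<le> ereal t * \<phi> x + ereal (1 - t) * \<phi> y - ereal (s / 2 * t * (1 - t) * (norm (x - y))\<^sup>2)"
  define m where "m = (1/2) *\<^sub>R y + (1/2) *\<^sub>R x"
  obtain a b where ab: "\<phi> x = ereal a" "\<phi> y = ereal b"
    using \<phi> v y by (cases "\<phi> x"; cases "\<phi> y") (auto simp: proper_fun_def eps_subdiff_def edom_def)
  have 1: "\<phi> m \<le> ereal (b/2 + a/2 - s / 8 * (norm (y - x))\<^sup>2)"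
    using s[rule_format, of "1/2" y x] ab by (simp add: m_def)
  have 2: "ereal (inner v (m - x)) \<le> \<phi> m - \<phi> x + ereal \<delta>"
    using v by (auto simp: eps_subdiff_def)
  obtain c where c: "\<phi> m = ereal c"
    using 1 2 ab \<phi> by (cases "\<phi> m") (auto simp: proper_fun_def)
  have "m - x = (1/2) *\<^sub>R (y - x)"
    unfolding m_def by (simp add: algebra_simps flip: scaleR_add_left)
  then have "inner v (y - x) / 2 \<le> c - a + \<delta>"
    using 2 c ab by simp
  moreover have "c \<le> b/2 + a/2 - s / 8 * (norm (y - x))\<^sup>2" using 1 c by simp
  ultimately have "s * (norm (y - x))\<^sup>2 \<le> 4 * (b - a - inner v (y - x) + 2 * \<delta>)"
    by simp
  then show "ereal s \<le> ereal (4 * (real_of_ereal (\<phi> y) - real_of_ereal (\<phi> x)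
            - inner v (y - x) + 2 * \<delta>) / (norm (y - x))\<^sup>2)"
    using \<open>x \<noteq> y\<close> ab by (simp add: field_simps)
qed

lemma eps_subdiff_of_eps_solution:
  assumes g: "proper_fun g" and u: "eps_solution e (\<lambda>x. g x - ereal (inner v x)) u"
  shows "v \<in> eps_subdiff e g u"
proof -
  have le: "g u - ereal (inner v u) \<le> (g x - ereal (inner v x)) + ereal e" for x
  proof -
    have "g u - ereal (inner v u) \<le> (INF x. g x - ereal (inner v x)) + ereal e"
      using u by (simp add: eps_solution_def)
    also have "\<dots> \<le> (g x - ereal (inner v x)) + ereal e"
      by (intro add_right_mono INF_lower) auto
    finally show ?thesis .
  qed
  obtain z where z: "g z < \<infinity>" using g by (auto simp: proper_fun_def edom_def)
  have fin: "g u < \<infinity>"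
    using le[of z] z by (cases "g u"; cases "g z") auto
  have "ereal (inner v (x - u)) \<le> g x - g u + ereal e" for x
    using le[of x] fin g by (cases "g u"; cases "g x") (auto simp: proper_fun_def inner_diff_right)
  then show ?thesis using fin by (auto simp: eps_subdiff_def edom_def)
qed

section \<open>Proximal points, and exact subgradients near approximate ones\<close>

lemma lsc_fun_eventually_nhds:
  assumes "lsc_fun \<phi>" "y < \<phi> x"
  shows "\<forall>\<^sub>F z in nhds x. y < \<phi> z"
proof -
  have "\<phi> x \<le> Liminf (at x) \<phi>" using assms by (simp add: lsc_fun_def)
  then have "\<forall>\<^sub>F z in at x. y < \<phi> z" using assms by (auto simp: le_Liminf_iff)
  then show ?thesis using assms(2) by (auto simp: eventually_at_filter elim: eventually_mono)
qed

lemma lsc_fun_le_limit: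
  assumes "lsc_fun \<phi>" "X \<longlonglongrightarrow> x" "\<forall>n. \<phi> (X n) \<le> ereal (b n)" "b \<longlonglongrightarrow> l"
  shows "\<phi> x \<le> ereal l"
proof (rule ccontr)
  assume "\<not> ?thesis"
  then obtain c where c: "ereal l < c" "c < \<phi> x" using dense[of "ereal l" "\<phi> x"] by (auto simp: not_le)
  have "\<forall>\<^sub>F n in sequentially. c < \<phi> (X n)"
    using lsc_fun_eventually_nhds[OF assms(1) c(2)] assms(2) by (auto simp: filterlim_iff)
  moreover have "\<forall>\<^sub>F n in sequentially. ereal (b n) < c"
    using order_tendstoD(2)[OF tendsto_ereal[OF assms(4)] c(1)] .
  ultimately have "\<forall>\<^sub>F n in sequentially. False"
    by eventually_elim (use assms(3) in \<open>meson leD le_less_trans less_trans\<close>)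
  then show False by simp
qed

lemma convex_fun_real:
  assumes "convex_fun \<phi>" "proper_fun \<phi>" "\<phi> x = ereal a" "\<phi> y = ereal b" "0 \<le> t" "t \<le> 1"
  obtains c where "\<phi> (x + t *\<^sub>R (y - x)) = ereal c" "c \<le> (1 - t) * a + t * b"
proof -
  have "t *\<^sub>R y + (1 - t) *\<^sub>R x = x + t *\<^sub>R (y - x)" by (simp add: algebra_simps)
  moreover have "\<phi> (t *\<^sub>R y + (1 - t) *\<^sub>R x) \<le> ereal t * \<phi> y + ereal (1 - t) * \<phi> x"
    using assms(1)[unfolded convex_fun_def, rule_format, of t y x] assms(5,6) by simp
  ultimately have "\<phi> (x + t *\<^sub>R (y - x)) \<le> ereal ((1 - t) * a + t * b)"
    using assms(3,4) by (simp add: add.commute)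
  then show thesis
    using that assms(2) by (cases "\<phi> (x + t *\<^sub>R (y - x))") (auto simp: proper_fun_def)
qed

lemma eps_subdiff_real:
  assumes "v \<in> eps_subdiff e \<phi> x" "\<phi> x = ereal a" "\<phi> y = ereal b"
  shows "a + inner v (y - x) \<le> b + e"
  using assms by (auto simp: eps_subdiff_def dest!: spec[of _ y])

text \<open>The direct method: the quadratic term makes a minimizing sequence Cauchy, completeness
  supplies its limit, and lower semicontinuity makes the limit a minimizer. The approximate
  subgradient \<open>v\<close> bounds the objective from below.\<close>

lemma prox_minimizer_exists:
  fixes x :: "'a::{real_inner, complete_space}"
  assumes \<phi>: "proper_fun \<phi>" "lsc_fun \<phi>" "convex_fun \<phi>" and v: "v \<in> eps_subdiff \<delta> \<phi> x"
  obtains p a where "\<phi> p = ereal a"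
    "\<And>y b. \<phi> y = ereal b \<Longrightarrow>
      a - inner v p + (norm (p - x))\<^sup>2 / 2 \<le> b - inner v y + (norm (y - x))\<^sup>2 / 2"
proof -
  define \<psi> where "\<psi> y = real_of_ereal (\<phi> y) - inner v y + (norm (y - x))\<^sup>2 / 2" for y
  define S where "S = \<psi> ` edom \<phi>"
  have dom: "\<exists>b. \<phi> y = ereal b" if "y \<in> edom \<phi>" for y
    using that \<phi>(1) by (cases "\<phi> y") (auto simp: edom_def proper_fun_def)
  have xd: "x \<in> edom \<phi>" using v by (auto simp: eps_subdiff_def)
  then obtain a0 where a0: "\<phi> x = ereal a0" using dom by auto
  have lower: "a0 - inner v x - \<delta> \<le> \<psi> y" if y: "y \<in> edom \<phi>" for y
  proof -
    obtain b where b: "\<phi> y = ereal b" using dom y by auto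
    have "a0 + inner v (y - x) \<le> b + \<delta>" using eps_subdiff_real[OF v a0 b] .
    moreover have "0 \<le> (norm (y - x))\<^sup>2 / 2" by simp
    ultimately show ?thesis unfolding \<psi>_def b inner_diff_right real_of_ereal.simps by linarith
  qed
  have bdd: "bdd_below S" using lower by (auto simp: S_def bdd_below_def)
  define m where "m = Inf S"
  have m_le: "m \<le> \<psi> y" if "y \<in> edom \<phi>" for y
    unfolding m_def using that bdd by (auto intro: cInf_lower simp: S_def)
  have "\<exists>y\<in>edom \<phi>. \<psi> y < m + 1 / real (Suc n)" for n
  proof -
    have "S \<noteq> {}" "Inf S < m + 1 / real (Suc n)" using xd by (auto simp: S_def m_def)
    then show ?thesis by (subst (asm) cInf_less_iff) (use bdd in \<open>auto simp: S_def\<close>)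
  qed
  then obtain X where X: "\<And>n. X n \<in> edom \<phi>" "\<And>n. \<psi> (X n) < m + 1 / real (Suc n)" by metis
  \<comment> \<open>By the parallelogram law the quadratic term at the midpoint lies
    \<open>(norm (y - z))\<^sup>2 / 8\<close> below the average of its end values, while the
    objective there is still at least \<open>m\<close>.\<close>
  have mid: "(norm (y - z))\<^sup>2 / 8 \<le> (\<psi> y + \<psi> z) / 2 - m" if yz: "y \<in> edom \<phi>" "z \<in> edom \<phi>" for y z
  proof -
    obtain b c where bc: "\<phi> y = ereal b" "\<phi> z = ereal c" using dom yz by blast
    obtain d where d: "\<phi> (y + (1/2) *\<^sub>R (z - y)) = ereal d" "d \<le> (1 - 1/2) * b + (1/2) * c"
      using convex_fun_real[OF \<phi>(3,1) bc, of "1/2"] by auto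
    define q where "q = y + (1/2) *\<^sub>R (z - y)"
    have "m \<le> \<psi> q" by (rule m_le) (simp add: edom_def q_def d)
    moreover have "inner v q = (inner v y + inner v z) / 2"
      by (simp add: q_def inner_simps field_simps)
    moreover have "(norm (q - x))\<^sup>2 = ((norm (y - x))\<^sup>2 + (norm (z - x))\<^sup>2) / 2 - (norm (y - z))\<^sup>2 / 4"
      unfolding q_def power2_norm_eq_inner
      by (simp add: inner_simps inner_commute field_simps)
    ultimately show ?thesis using bc d by (simp add: \<psi>_def q_def field_simps)
  qed
  have "Cauchy X"
  proof (rule metric_CauchyI)
    fix e :: real assume "0 < e"
    then obtain N where N: "inverse (real (Suc N)) < e\<^sup>2 / 8"
      using reals_Archimedean[of "e\<^sup>2 / 8"] by auto
    have small: "\<psi> (X i) < m + e\<^sup>2 / 8" if "N \<le> i" for i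
    proof -
      have "1 / real (Suc i) \<le> inverse (real (Suc N))" using that by (simp add: field_simps)
      then have "1 / real (Suc i) < e\<^sup>2 / 8" using N by (rule le_less_trans)
      then show ?thesis using X(2)[of i] by linarith
    qed
    show "\<exists>M. \<forall>i\<ge>M. \<forall>j\<ge>M. dist (X i) (X j) < e"
    proof (intro exI allI impI)
      fix i j assume "N \<le> i" "N \<le> j"
      then have "(\<psi> (X i) + \<psi> (X j)) / 2 - m < e\<^sup>2 / 8"
        using small[of i] small[of j] by (simp add: field_simps)
      then have "(norm (X i - X j))\<^sup>2 < e\<^sup>2"
        using mid[OF X(1) X(1), of i j] by linarith
      then show "dist (X i) (X j) < e"
        using \<open>0 < e\<close> by (simp add: dist_norm power2_less_imp_less)
    qed
  qed
  then obtain p where p: "X \<longlonglongrightarrow> p" using Cauchy_convergent_iff convergent_def by blast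
  \<comment> \<open>The bound on \<open>\<psi> (X n)\<close> solved for \<open>\<phi> (X n)\<close>:
    the other terms are continuous, so semicontinuity is applied to \<open>\<phi>\<close>
    alone.\<close>
  define bs where "bs n = m + 1 / real (Suc n) + inner v (X n) - (norm (X n - x))\<^sup>2 / 2" for n
  have "\<phi> (X n) \<le> ereal (bs n)" for n
    using X(2)[of n] dom[OF X(1), of n] by (auto simp: \<psi>_def bs_def)
  moreover have "bs \<longlonglongrightarrow> m + 0 + inner v p - (norm (p - x))\<^sup>2 / 2"
    unfolding bs_def by (intro tendsto_intros p LIMSEQ_Suc[OF lim_1_over_n]) auto
  ultimately have le: "\<phi> p \<le> ereal (m + 0 + inner v p - (norm (p - x))\<^sup>2 / 2)"
    using lsc_fun_le_limit[OF \<phi>(2) p] by blast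
  then have pd: "p \<in> edom \<phi>" by (auto simp: edom_def)
  then obtain a where a: "\<phi> p = ereal a" using dom by auto
  show thesis
  proof
    show "\<phi> p = ereal a" by fact
    fix y b assume b: "\<phi> y = ereal b"
    then have "m \<le> \<psi> y" by (intro m_le) (simp add: edom_def)
    then show "a - inner v p + (norm (p - x))\<^sup>2 / 2 \<le> b - inner v y + (norm (y - x))\<^sup>2 / 2"
      using le a b by (simp add: \<psi>_def)
  qed
qed

text \<open>In a Hilbert space a proximal point replaces Ekeland's variational principle in the
  Broendsted--Rockafellar argument.\<close>

lemma eps_subdiff_approximation:
  fixes x :: "'a::{real_inner, complete_space}"
  assumes \<phi>: "proper_fun \<phi>" "lsc_fun \<phi>" "convex_fun \<phi>" and v: "v \<in> eps_subdiff \<delta> \<phi> x"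
  obtains p z where "z \<in> convex_subdiff \<phi> p" "norm (p - x) \<le> sqrt (2 * \<delta>)" "norm (z - v) \<le> sqrt (2 * \<delta>)"
proof -
  obtain p a where a: "\<phi> p = ereal a" and
    min: "\<And>y b. \<phi> y = ereal b \<Longrightarrow>
      a - inner v p + (norm (p - x))\<^sup>2 / 2 \<le> b - inner v y + (norm (y - x))\<^sup>2 / 2"
    using prox_minimizer_exists[OF \<phi> v] by metis
  \<comment> \<open>Suggested by first-order optimality at \<open>p\<close>: the quadratic term has
    gradient \<open>p - x\<close> there.\<close>
  define z where "z = v - (p - x)"
  have "x \<in> edom \<phi>" using v by (auto simp: eps_subdiff_def)
  then obtain b where b: "\<phi> x = ereal b"
    using \<phi>(1) by (cases "\<phi> x") (auto simp: edom_def proper_fun_def)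
  \<comment> \<open>The minimizer \<open>p\<close> is compared with the competitor \<open>x\<close>,
    and the inequality for \<open>v\<close> at \<open>x\<close> is evaluated at
    \<open>p\<close>.\<close>
  have "(norm (p - x))\<^sup>2 \<le> 2 * \<delta>"
    using min[OF b] eps_subdiff_real[OF v b a] by (simp add: inner_diff_right)
  then have *: "norm (p - x) \<le> sqrt (2 * \<delta>)" by (rule real_le_rsqrt)
  have "ereal (inner z (y - p)) \<le> \<phi> y - \<phi> p + ereal 0" for y
  proof (cases "\<phi> y")
    case (real c)
    \<comment> \<open>The slack in the wanted inequality. Minimality of \<open>p\<close> against
      \<open>p + t *\<^sub>R (y - p)\<close>, divided by \<open>t\<close>, bounds it below up to a
      quadratic remainder of order \<open>t\<close>, which vanishes as \<open>t\<close> tends to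
      0.\<close>
    define D where "D = c - a - inner z (y - p)"
    have "0 \<le> D + t * ((norm (y - p))\<^sup>2 / 2)" if t: "0 < t" "t \<le> 1" for t
    proof -
      define q where "q = p + t *\<^sub>R (y - p)"
      obtain d where d: "\<phi> q = ereal d" "d \<le> (1 - t) * a + t * c"
        using convex_fun_real[OF \<phi>(3,1) a real, of t] t unfolding q_def by auto
      have "(norm (q - x))\<^sup>2 = (norm (p - x))\<^sup>2 + 2 * t * inner (p - x) (y - p) + t\<^sup>2 * (norm (y - p))\<^sup>2"
        unfolding q_def power2_norm_eq_inner
        by (simp add: inner_simps inner_commute field_simps power2_eq_square)
      moreover have "inner v q = inner v p + t * inner v (y - p)"
        by (simp add: q_def inner_simps)
      ultimately have "0 \<le> t * (D + t * ((norm (y - p))\<^sup>2 / 2))"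
        using min[OF d(1)] d(2)
        by (simp add: D_def z_def inner_diff_left algebra_simps power2_eq_square)
      then show ?thesis using t by (simp add: zero_le_mult_iff)
    qed
    then have ev: "\<forall>\<^sub>F t in at_right 0. 0 \<le> D + t * ((norm (y - p))\<^sup>2 / 2)"
      by (intro eventually_at_rightI[of 0 1]) auto
    have lim: "((\<lambda>t. D + t * ((norm (y - p))\<^sup>2 / 2)) \<longlongrightarrow> D + 0 * ((norm (y - p))\<^sup>2 / 2)) (at_right 0)"
      by (intro tendsto_intros)
    have "0 \<le> D + 0 * ((norm (y - p))\<^sup>2 / 2)"
      using tendsto_lowerbound[OF lim ev] by simp
    then show ?thesis using real a by (simp add: D_def)
  qed (use a \<phi>(1) in \<open>auto simp: proper_fun_def\<close>)
  then have "z \<in> convex_subdiff \<phi> p" using a by (auto simp: eps_subdiff_def edom_def)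
  moreover have "norm (z - v) \<le> sqrt (2 * \<delta>)" using * by (simp add: z_def norm_minus_commute)
  ultimately show thesis using that * by blast
qed

section \<open>Smooth functions and subgradients of convex-minus-smooth differences\<close>

text \<open>The descent lemma, with \<open>L\<close> where integration would give
  \<open>L / 2\<close>: the mean value theorem on the segment evaluates the gradient at one
  intermediate point, and its distance from \<open>y\<close> is bounded by the full length.\<close>

lemma gradient_lipschitz_upper_bound:
  fixes R :: "'a::real_inner \<Rightarrow> real"
  assumes G: "\<And>z. GDERIV R z :> G z" and L: "L-lipschitz_on UNIV G"
  shows "R x \<le> R y + inner (G y) (x - y) + L * (norm (x - y))\<^sup>2"
proof -
  define d where "d = x - y"
  have deriv: "DERIV (\<lambda>t. R (y + t *\<^sub>R d)) t :> inner (G (y + t *\<^sub>R d)) d" for t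
  proof -
    have "((\<lambda>t. R (y + t *\<^sub>R d)) has_derivative (\<lambda>s. inner (s *\<^sub>R d) (G (y + t *\<^sub>R d)))) (at t)"
    proof (rule has_derivative_compose[where f = "\<lambda>t. y + t *\<^sub>R d"])
      show "((\<lambda>t. y + t *\<^sub>R d) has_derivative (\<lambda>s. s *\<^sub>R d)) (at t)"
        by (auto intro!: derivative_eq_intros)
    qed (use G in \<open>simp add: gderiv_def\<close>)
    then show ?thesis
      by (rule has_derivative_imp_has_field_derivative) (simp add: inner_commute)
  qed
  obtain s where s: "0 < s" "s < 1" "R (y + 1 *\<^sub>R d) - R (y + 0 *\<^sub>R d) = (1 - 0) * inner (G (y + s *\<^sub>R d)) d"
    using MVT2[of 0 1 "\<lambda>t. R (y + t *\<^sub>R d)", OF _ deriv] by auto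
  have "norm (G (y + s *\<^sub>R d) - G y) \<le> L * norm (s *\<^sub>R d)"
    using lipschitz_onD[OF L, of "y + s *\<^sub>R d" y] by (simp add: dist_norm)
  also have "\<dots> \<le> L * norm d"
    using s lipschitz_on_nonneg[OF L] by (intro mult_left_mono) (auto simp: mult_left_le_one_le)
  finally have "inner (G (y + s *\<^sub>R d) - G y) d \<le> L * norm d * norm d"
    by (meson norm_cauchy_schwarz mult_right_mono norm_ge_zero order_trans)
  then show ?thesis using s by (simp add: d_def inner_diff_left power2_eq_square)
qed

lemma eps_subdiff_near_gradient:
  fixes \<psi> :: "'a::real_inner \<Rightarrow> ereal"
  assumes fin: "\<And>z. \<bar>\<psi> z\<bar> \<noteq> \<infinity>" and G: "\<And>z. GDERIV (\<lambda>x. real_of_ereal (\<psi> x)) z :> G z"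
    and L: "L-lipschitz_on UNIV G" "L > 0" and v: "v \<in> eps_subdiff e \<psi> y"
  shows "norm (v - G y) \<le> 2 * sqrt (L * e)"
proof -
  define z where "z = v - G y"
  \<comment> \<open>This displacement maximizes
    \<open>inner z (x - y) - L * (norm (x - y))\<^sup>2\<close>; the maximum
    \<open>(norm z)\<^sup>2 / (4 * L)\<close> is then at most \<open>e\<close>.\<close>
  define x where "x = y + (1 / (2 * L)) *\<^sub>R z"
  have xy: "x - y = (1 / (2 * L)) *\<^sub>R z" by (simp add: x_def)
  have "real_of_ereal (\<psi> y) + inner v (x - y) \<le> real_of_ereal (\<psi> x) + e"
    using eps_subdiff_real[OF v, of _ x] fin by (simp add: ereal_real)
  moreover have "real_of_ereal (\<psi> x) \<le> real_of_ereal (\<psi> y) + inner (G y) (x - y) + L * (norm (x - y))\<^sup>2"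
    by (rule gradient_lipschitz_upper_bound[OF G L(1)])
  ultimately have "inner z (x - y) \<le> e + L * (norm (x - y))\<^sup>2"
    by (simp add: z_def inner_diff_left)
  then have "(norm z)\<^sup>2 / (2 * L) \<le> e + (norm z)\<^sup>2 / (4 * L)"
    using L(2) by (simp add: xy power_mult_distrib power2_norm_eq_inner power_divide)
      (simp add: field_simps power2_eq_square)
  then have "(norm z)\<^sup>2 \<le> 4 * (L * e)" using L(2) by (simp add: field_simps)
  then have "norm z \<le> sqrt (4 * (L * e))" by (rule real_le_rsqrt)
  then show ?thesis by (simp add: z_def real_sqrt_mult)
qed

text \<open>The subgradient inequality of \<open>\<phi>\<close> holds globally, and
  \<open>\<psi>\<close> differs from its tangent at \<open>x\<close> by a term of smaller order than
  \<open>norm (z - x)\<close>, so the difference quotient has nonnegative lower limit.\<close>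

lemma frechet_subdiff_convex_minus_smooth:
  fixes \<phi> \<psi> :: "'a::real_inner \<Rightarrow> ereal"
  assumes \<phi>: "proper_fun \<phi>" and v: "v \<in> convex_subdiff \<phi> x"
    and fin: "\<And>z. \<bar>\<psi> z\<bar> \<noteq> \<infinity>" and D: "GDERIV (\<lambda>x. real_of_ereal (\<psi> x)) x :> D"
  shows "v - D \<in> frechet_subdiff (\<lambda>z. \<phi> z - \<psi> z) x"
proof -
  obtain a where a: "\<phi> x = ereal a"
    using v \<phi> by (cases "\<phi> x") (auto simp: eps_subdiff_def edom_def proper_fun_def)
  define R where "R z = real_of_ereal (\<psi> z)" for z
  have R: "\<psi> z = ereal (R z)" for z using fin by (simp add: R_def ereal_real)
  define Q where "Q z = (\<phi> z - \<psi> z - (\<phi> x - \<psi> x) - ereal (inner (v - D) (z - x))) / ereal (norm (z - x))" for z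
  have "0 \<le> Liminf (at x) Q"
    unfolding le_Liminf_iff
  proof (intro allI impI)
    fix c :: ereal assume "c < 0"
    \<comment> \<open>Since \<open>c\<close> may be \<open>-\<infinity>\<close>, a real number in
      between is taken: \<open>- c0\<close> is the tolerance for differentiability, and the gap to
      \<open>c\<close> makes the final inequality strict.\<close>
    then obtain c0 where c0: "c < ereal c0" "ereal c0 < 0" using ereal_dense2 by blast
    have "\<forall>e>0. \<exists>d>0. \<forall>y. norm (y - x) < d \<longrightarrow> norm (R y - R x - inner (y - x) D) \<le> e * norm (y - x)"
      using D by (simp add: R_def[abs_def] gderiv_def has_derivative_at_alt)
    moreover have "- c0 > 0" using c0 by simp
    ultimately obtain d where d: "d > 0"
      "\<And>y. norm (y - x) < d \<Longrightarrow> norm (R y - R x - inner (y - x) D) \<le> - c0 * norm (y - x)" by blast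
    show "\<forall>\<^sub>F z in at x. c < Q z"
      unfolding eventually_at
    proof (intro exI conjI ballI impI)
      fix z assume z: "z \<noteq> x \<and> dist z x < d"
      have "ereal c0 \<le> Q z"
      proof (cases "\<phi> z")
        case (real b)
        have "a + inner v (z - x) \<le> b" using eps_subdiff_real[OF v a real] by simp
        moreover have "R z - R x - inner D (z - x) \<le> - c0 * norm (z - x)"
          using d(2)[of z] z by (simp add: dist_norm inner_commute abs_le_iff)
        ultimately have "c0 * norm (z - x) \<le> b - R z - (a - R x) - inner (v - D) (z - x)"
          by (simp add: inner_diff_left)
        then show ?thesis using z by (simp add: Q_def real a R field_simps)
      next
        case PInf
        then show ?thesis using z by (simp add: Q_def a R)
      qed (use \<phi> in \<open>auto simp: proper_fun_def\<close>)
      with c0(1) show "c < Q z" by (rule less_le_trans)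
    qed (use d in auto)
  qed
  then show ?thesis unfolding frechet_subdiff_def Q_def[abs_def] by (simp add: a R)
qed

lemma frechet_subdiff_subset_limiting: "frechet_subdiff \<phi> x \<subseteq> limiting_subdiff \<phi> x"
proof
  fix v assume v: "v \<in> frechet_subdiff \<phi> x"
  then have "\<bar>\<phi> x\<bar> \<noteq> \<infinity>" by (simp add: frechet_subdiff_def)
  with v show "v \<in> limiting_subdiff \<phi> x"
    unfolding limiting_subdiff_def mem_Collect_eq
    by (intro conjI exI[of _ "\<lambda>_. x"] exI[of _ "\<lambda>_. v"]) (auto simp: weakly_converges_def)
qed

text \<open>Serves both smoothness cases, with \<open>\<phi>\<close> the function not assumed
  smooth. The subgradient \<open>z - G p\<close> splits into the proximal error
  \<open>z - v\<close>, the inexactness \<open>v - G y\<close> and the gradient change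
  \<open>G y - G p\<close>. It lives at the proximal point \<open>p\<close>, not at
  \<open>x\<close>, because only there is an exact subgradient of \<open>\<phi>\<close>
  known.\<close>

lemma approximate_limiting_subgradient:
  fixes \<phi> \<psi> :: "'a::{real_inner, complete_space} \<Rightarrow> ereal"
  assumes \<phi>: "proper_fun \<phi>" "lsc_fun \<phi>" "convex_fun \<phi>" and vx: "v \<in> eps_subdiff \<delta> \<phi> x"
    and fin: "\<And>z. \<bar>\<psi> z\<bar> \<noteq> \<infinity>" and G: "\<And>z. GDERIV (\<lambda>x. real_of_ereal (\<psi> x)) z :> G z"
    and L: "L-lipschitz_on UNIV G" "L > 0" and vy: "v \<in> eps_subdiff e \<psi> y"
  obtains p \<xi> where "p \<in> edom \<phi>" "\<xi> \<in> limiting_subdiff (\<lambda>z. \<phi> z - \<psi> z) p" "norm (p - x) \<le> sqrt (2 * \<delta>)"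
    "norm \<xi> \<le> (1 + L) * sqrt (2 * \<delta>) + 2 * sqrt (L * e) + L * norm (x - y)"
proof -
  obtain p z where z: "z \<in> convex_subdiff \<phi> p" and p: "norm (p - x) \<le> sqrt (2 * \<delta>)"
    and zv: "norm (z - v) \<le> sqrt (2 * \<delta>)"
    using eps_subdiff_approximation[OF \<phi> vx] .
  have "norm (G y - G p) \<le> L * norm (y - p)"
    using lipschitz_onD[OF L(1), of y p] by (simp add: dist_norm)
  also have "\<dots> \<le> L * (norm (x - y) + sqrt (2 * \<delta>))"
    using p norm_triangle_ineq[of "y - x" "x - p"] L(2)
    by (intro mult_left_mono) (auto simp: norm_minus_commute)
  finally have 1: "norm (G y - G p) \<le> L * (norm (x - y) + sqrt (2 * \<delta>))" .
  have 2: "norm (v - G y) \<le> 2 * sqrt (L * e)"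
    by (rule eps_subdiff_near_gradient[OF fin G L vy])
  have "norm (z - G p) \<le> norm (z - v) + norm (v - G y) + norm (G y - G p)"
    using norm_triangle_ineq[of "z - v" "v - G p"] norm_triangle_ineq[of "v - G y" "G y - G p"] by simp
  then have "norm (z - G p) \<le> (1 + L) * sqrt (2 * \<delta>) + 2 * sqrt (L * e) + L * norm (x - y)"
    using 1 2 zv by (simp add: algebra_simps)
  moreover have "z - G p \<in> limiting_subdiff (\<lambda>z. \<phi> z - \<psi> z) p"
    using frechet_subdiff_convex_minus_smooth[OF \<phi>(1) z fin G] frechet_subdiff_subset_limiting by blast
  moreover have "p \<in> edom \<phi>" using z by (simp add: eps_subdiff_def)
  ultimately show thesis using that p by blast
qed

section \<open>A uniform Lipschitz constant near a compact set\<close>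

lemma locally_lipschitz_near_compact:
  assumes f: "locally_lipschitz_wrt_dom f" and \<Omega>: "compact \<Omega>" "\<Omega> \<noteq> {}" "\<Omega> \<subseteq> edom f"
  obtains \<rho> L where "0 < \<rho>" "0 \<le> L"
    "\<And>x y. \<lbrakk>x \<in> edom f; y \<in> edom f; infdist x \<Omega> < \<rho>; dist x y < \<rho>\<rbrakk>
      \<Longrightarrow> \<bar>real_of_ereal (f x) - real_of_ereal (f y)\<bar> \<le> L * dist x y"
proof -
  have "\<forall>z\<in>\<Omega>. \<exists>r L. r > 0 \<and> L-lipschitz_on (ball z r \<inter> edom f) (\<lambda>u. real_of_ereal (f u))"
    using f \<Omega>(3) unfolding locally_lipschitz_wrt_dom_def by blast
  then obtain R K where RK: "\<And>z. z \<in> \<Omega> \<Longrightarrow> R z > 0"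
    "\<And>z. z \<in> \<Omega> \<Longrightarrow> (K z)-lipschitz_on (ball z (R z) \<inter> edom f) (\<lambda>u. real_of_ereal (f u))" by metis
  have "\<Omega> \<subseteq> (\<Union>z\<in>\<Omega>. ball z (R z / 2))" using RK(1) by force
  then obtain T where T: "T \<subseteq> \<Omega>" "finite T" "\<Omega> \<subseteq> (\<Union>z\<in>T. ball z (R z / 2))"
    using compactE_image[OF \<Omega>(1), of \<Omega> "\<lambda>z. ball z (R z / 2)"] by auto
  have "T \<noteq> {}" using T(3) \<Omega>(2) by auto
  \<comment> \<open>With half radii in the cover, a quarter leaves room for two steps:
    \<open>x\<close> is within \<open>R z / 2 + \<rho>\<close> of the centre \<open>z\<close>, and
    \<open>y\<close> within \<open>R z / 2 + 2 * \<rho> \<le> R z\<close>.\<close>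
  define \<rho> where "\<rho> = Min ((\<lambda>z. R z / 4) ` T)"
  define L where "L = Max (K ` T)"
  have \<rho>: "\<rho> \<le> R z / 4" if "z \<in> T" for z
    unfolding \<rho>_def using that T(2) by (intro Min_le) auto
  have L: "K z \<le> L" if "z \<in> T" for z using that T(2) by (simp add: L_def)
  show thesis
  proof
    show "0 < \<rho>" using T \<open>T \<noteq> {}\<close> RK(1) by (auto simp: \<rho>_def)
    obtain z where "z \<in> T" using \<open>T \<noteq> {}\<close> by blast
    then show "0 \<le> L" using L[of z] lipschitz_on_nonneg[OF RK(2)[of z]] T(1) by auto
    fix x y assume xy: "x \<in> edom f" "y \<in> edom f" "infdist x \<Omega> < \<rho>" "dist x y < \<rho>"
    have "(INF q\<in>\<Omega>. dist x q) < \<rho>" using xy(3) \<Omega>(2) by (simp add: infdist_def)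
    then obtain q where q: "q \<in> \<Omega>" "dist x q < \<rho>"
      by (subst (asm) cINF_less_iff) (auto simp: \<Omega>(2) bdd_below.I2[of _ 0])
    then obtain z where z: "z \<in> T" "dist z q < R z / 2" using T(3) by auto
    have "dist z x < R z / 2 + \<rho>" using dist_triangle[of z x q] z(2) q(2) by (simp add: dist_commute)
    then have "x \<in> ball z (R z)" "y \<in> ball z (R z)"
      using \<rho>[OF z(1)] dist_triangle[of z y x] xy(4) RK(1)[of z] z(1) T(1) by auto
    then have "\<bar>real_of_ereal (f x) - real_of_ereal (f y)\<bar> \<le> K z * dist x y"
      using lipschitz_onD[OF RK(2)[of z], of x y] xy z(1) T(1) by (auto simp: dist_real_def)
    also have "\<dots> \<le> L * dist x y" using L[OF z(1)] by (simp add: mult_right_mono)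
    finally show "\<bar>real_of_ereal (f x) - real_of_ereal (f y)\<bar> \<le> L * dist x y" .
  qed
qed

section \<open>The values on exit from the inner loop, and descent\<close>

lemma adca_inner_final:
  assumes "adca_inner a b g h \<gamma> w e e' v u" "0 < e" "0 < \<gamma>" "\<gamma> < 1"
  shows "adca_trial a b g h w e' v u" "ereal e' \<le> adca_bound g h w u" "0 < e'" "e' \<le> e"
proof -
  have "adca_trial a b g h w e' v u \<and> ereal e' \<le> adca_bound g h w u \<and> 0 < e' \<and> e' \<le> e"
    using assms
  proof (induction rule: adca_inner.induct)
    case (restart e v u e' v' u')
    moreover have "\<gamma> * e \<le> e" using restart by (simp add: mult_left_le_one_le)
    ultimately show ?case by auto
  qed auto
  then show "adca_trial a b g h w e' v u" "ereal e' \<le> adca_bound g h w u" "0 < e'" "e' \<le> e" by auto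
qed

text \<open>Reduces the nested loops to facts about exit values. The bound by 1 persists since no
  update increases the tolerance; it ensures that the power with exponent
  \<open>1 / \<theta>\<close> does not exceed the tolerance itself.\<close>

lemma adca_generated_final:
  assumes "adca_generated a b g h \<epsilon> u v w"
  shows "g (u 0) - h (u 0) < \<infinity>" "g (w k) - h (w k) \<le> g (u k) - h (u k)"
    "adca_trial a b g h (w k) (\<epsilon> k) (v k) (u (Suc k))" "ereal (\<epsilon> k) \<le> adca_bound g h (w k) (u (Suc k))"
    "0 < \<epsilon> k" "\<epsilon> k \<le> 1"
proof -
  obtain \<gamma> e where u0: "g (u 0) - h (u 0) < \<infinity>" and \<gamma>: "0 < \<gamma>" "\<gamma> < 1" and e0: "0 < e 0" "e 0 \<le> 1"
    and iter: "\<And>k. g (w k) - h (w k) \<le> g (u k) - h (u k)"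
      "\<And>k. adca_inner a b g h \<gamma> (w k) (e k) (\<epsilon> k) (v k) (u (Suc k))"
      "\<And>k. 0 < e (Suc k)" "\<And>k. e (Suc k) \<le> \<epsilon> k"
    using assms unfolding adca_generated_def by (auto simp: edom_def)
  have epos: "0 < e k" for k using e0 iter(3) by (cases k) auto
  note fin = adca_inner_final[OF iter(2) epos \<gamma>]
  have e1: "e k \<le> 1" for k
  proof (induction k)
    case (Suc k)
    then show ?case using iter(4)[of k] fin(4)[of k] by linarith
  qed (use e0 in simp)
  show "g (u 0) - h (u 0) < \<infinity>" "g (w k) - h (w k) \<le> g (u k) - h (u k)"
    "adca_trial a b g h (w k) (\<epsilon> k) (v k) (u (Suc k))" "ereal (\<epsilon> k) \<le> adca_bound g h (w k) (u (Suc k))"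
    "0 < \<epsilon> k" "\<epsilon> k \<le> 1"
    using u0 iter(1) fin[of k] e1[of k] by auto
qed

lemma tightened_bounds:
  assumes "0 \<le> \<theta>" "\<theta> < 1" "0 < e" "e \<le> 1"
  shows "0 \<le> tightened \<theta> e" "tightened \<theta> e \<le> e"
proof -
  show "0 \<le> tightened \<theta> e" by (simp add: tightened_def)
  have "e powr (1 / \<theta>) \<le> e powr 1" if "\<theta> \<noteq> 0"
    using assms that by (intro powr_mono') auto
  then show "tightened \<theta> e \<le> e" using assms by (auto simp: tightened_def)
qed

text \<open>The modulus bound is applied to \<open>g\<close> at \<open>u\<close> and to
  \<open>h\<close> at \<open>w\<close> with the same \<open>v\<close>, so the inner products cancel
  in the sum. The same bounds show both moduli to be finite, which makes a real \<open>s\<close>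
  available.\<close>

lemma adca_descent:
  assumes g: "proper_fun g" "convex_fun g" and h: "proper_fun h" "convex_fun h" "edom h = UNIV"
    and trial: "adca_trial a b g h w e v u" and tol: "a e \<le> e" "b e \<le> e" "0 < e"
    and bound: "ereal e \<le> adca_bound g h w u" and w: "w \<in> edom g"
  obtains s where "strong_convexity_modulus g + strong_convexity_modulus h = ereal s"
    "u \<in> edom g" "v \<in> eps_subdiff (b e) g u" "v \<in> eps_subdiff (a e) h w" "e \<le> s / 32 * (norm (u - w))\<^sup>2"
    "real_of_ereal (g u) - real_of_ereal (h u) + s / 8 * (norm (u - w))\<^sup>2
      \<le> real_of_ereal (g w) - real_of_ereal (h w)"
proof -
  have vh: "v \<in> eps_subdiff (a e) h w" using trial by (simp add: adca_trial_def)
  have vg: "v \<in> eps_subdiff (b e) g u"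
    using trial eps_subdiff_of_eps_solution[OF g(1)] by (simp add: adca_trial_def)
  then have u: "u \<in> edom g" by (simp add: eps_subdiff_def)
  \<comment> \<open>At \<open>u = w\<close> the exit bound would be 0, even for an infinite modulus
    since \<open>\<infinity> * 0 = 0\<close>, contradicting \<open>0 < e\<close>.\<close>
  have "u \<noteq> w"
  proof
    assume "u = w"
    then have "adca_bound g h w u = 0" by (simp add: adca_bound_def flip: zero_ereal_def)
    then show False using bound tol(3) by simp
  qed
  then have d: "0 < (norm (u - w))\<^sup>2" by simp
  have mg: "strong_convexity_modulus g \<le> ereal (4 * (real_of_ereal (g w) - real_of_ereal (g u)
            - inner v (w - u) + 2 * b e) / (norm (w - u))\<^sup>2)"
    by (rule strong_convexity_modulus_le[OF g(1) vg w]) fact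
  have mh: "strong_convexity_modulus h \<le> ereal (4 * (real_of_ereal (h u) - real_of_ereal (h w)
            - inner v (u - w) + 2 * a e) / (norm (u - w))\<^sup>2)"
    by (rule strong_convexity_modulus_le[OF h(1) vh]) (use h(3) \<open>u \<noteq> w\<close> in auto)
  obtain sg where sg: "strong_convexity_modulus g = ereal sg"
    using mg strong_convexity_modulus_nonneg[OF g(2)] by (cases "strong_convexity_modulus g") auto
  obtain sh where sh: "strong_convexity_modulus h = ereal sh"
    using mh strong_convexity_modulus_nonneg[OF h(2)] by (cases "strong_convexity_modulus h") auto
  define P where "P = sg * (norm (u - w))\<^sup>2"
  define Q where "Q = sh * (norm (u - w))\<^sup>2"
  have e: "e \<le> (P + Q) / 32"
    using bound by (simp add: adca_bound_def sg sh P_def Q_def field_simps)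
  have "P \<le> 4 * (real_of_ereal (g w) - real_of_ereal (g u) - inner v (w - u) + 2 * b e)"
    using mg d unfolding sg ereal_less_eq P_def by (simp add: norm_minus_commute pos_le_divide_eq)
  moreover have "Q \<le> 4 * (real_of_ereal (h u) - real_of_ereal (h w) - inner v (u - w) + 2 * a e)"
    using mh d unfolding sh ereal_less_eq Q_def by (simp add: pos_le_divide_eq)
  moreover have "inner v (w - u) = - inner v (u - w)" by (simp add: inner_diff_right)
  \<comment> \<open>The errors add up to
    \<open>8 * (a e + b e) \<le> 16 * e \<le> (P + Q) / 2\<close> by the exit test. Half of
    \<open>P + Q\<close> survives, and division by 4 gives 1/8.\<close>
  ultimately have "real_of_ereal (g u) - real_of_ereal (h u) + (P + Q) / 8
      \<le> real_of_ereal (g w) - real_of_ereal (h w)"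
    using e tol by argo
  then show thesis using that[of "sg + sh"] e sg sh u vg vh by (simp add: P_def Q_def algebra_simps add_divide_distrib)
qed

section \<open>The Polyak-Lojasiewicz estimate at a single iteration\<close>

lemma powr_add_le_double:
  fixes x y p :: real
  assumes "0 \<le> x" "0 \<le> y" "0 \<le> p" "p \<le> 1"
  shows "(x + y) powr p \<le> 2 * (x powr p + y powr p)"
proof -
  have "(x + y) powr p \<le> (2 * max x y) powr p" using assms by (intro powr_mono2) auto
  also have "\<dots> = 2 powr p * max x y powr p" using assms by (simp add: powr_mult)
  also have "\<dots> \<le> 2 powr 1 * (x powr p + y powr p)"
    using assms by (intro mult_mono powr_mono) (auto simp: max_def)
  finally show ?thesis by simp
qed

text \<open>The outer exponent cancels \<open>1 / \<theta>\<close> and leaves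
  \<open>e powr (1 / 2)\<close>; the factor 2 absorbs \<open>2 powr (\<theta> / 2)\<close>.\<close>

lemma sqrt_tightened_powr:
  assumes "0 < \<theta>" "\<theta> < 1" "0 < e"
  shows "sqrt (2 * tightened \<theta> e) powr \<theta> \<le> 2 * sqrt e"
proof -
  have "sqrt (2 * tightened \<theta> e) powr \<theta> = 2 powr (\<theta> / 2) * e powr (1 / 2)"
    using assms by (simp add: tightened_def powr_mult powr_powr flip: powr_half_sqrt)
  also have "\<dots> \<le> 2 powr 1 * e powr (1 / 2)"
    using assms by (intro mult_right_mono powr_mono) auto
  finally show ?thesis using assms by (simp add: powr_half_sqrt)
qed

text \<open>Here \<open>x\<close> is the point of the tightened step, \<open>y\<close> that of the
  ordinary one, and \<open>s\<close> the sum of the moduli. The inequality is used at the proximal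
  point \<open>p\<close>, and the Lipschitz bound carries the value back to \<open>x\<close>. The
  exit test turns each error into a multiple of \<open>norm (x - y)\<close>.\<close>

lemma PL_estimate_at_trial:
  fixes \<phi> \<psi> :: "'a::{real_inner, complete_space} \<Rightarrow> ereal" and F :: "'a \<Rightarrow> real"
  assumes \<phi>: "proper_fun \<phi>" "lsc_fun \<phi>" "convex_fun \<phi>"
    and fin: "\<And>z. \<bar>\<psi> z\<bar> \<noteq> \<infinity>" and G: "\<And>z. GDERIV (\<lambda>x. real_of_ereal (\<psi> x)) z :> G z"
    and L: "L-lipschitz_on UNIV G" "L > 0"
    and PL: "\<And>p \<xi>. \<lbrakk>infdist p \<Omega> \<le> r; \<xi> \<in> limiting_subdiff (\<lambda>z. \<phi> z - \<psi> z) p\<rbrakk>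
      \<Longrightarrow> \<bar>F p - c\<bar> powr \<theta> \<le> C * norm \<xi>"
    and lip: "\<And>x p. \<lbrakk>x \<in> edom \<phi>; p \<in> edom \<phi>; infdist x \<Omega> < \<rho>; dist x p < \<rho>\<rbrakk>
      \<Longrightarrow> \<bar>F x - F p\<bar> \<le> l * dist x p"
    and const: "0 \<le> \<theta>" "\<theta> < 1" "0 < C" "0 \<le> l" "0 \<le> s"
    and e: "0 < e" "e \<le> 1" "e \<le> s / 32 * (norm (x - y))\<^sup>2"
    and v: "v \<in> eps_subdiff (tightened \<theta> e) \<phi> x" "v \<in> eps_subdiff e \<psi> y"
    and near: "infdist x \<Omega> < min \<rho> (r / 2)" "sqrt (s / 16) * norm (x - y) < min \<rho> (r / 2)"
  shows "\<bar>F x - c\<bar> powr \<theta> \<le> 2 * (C * ((1 + L) * sqrt (s / 16) + 2 * sqrt (L * s / 32) + L)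
    + l powr \<theta> * (2 * sqrt (s / 32))) * norm (x - y)" (is "_ \<le> 2 * (C * ?B + ?E) * _")
proof -
  define d where "d = norm (x - y)"
  define \<delta> where "\<delta> = tightened \<theta> e"
  have \<delta>: "0 \<le> \<delta>" "\<delta> \<le> e" unfolding \<delta>_def by (rule tightened_bounds[OF const(1,2) e(1,2)])+
  have d: "0 \<le> d" "e \<le> s / 32 * d\<^sup>2" using e by (auto simp: d_def)
  have "2 * \<delta> \<le> s / 16 * d\<^sup>2" using \<delta> d by simp
  then have s\<delta>: "sqrt (2 * \<delta>) \<le> sqrt (s / 16) * d"
    using d(1) real_sqrt_le_mono[of "2 * \<delta>" "s / 16 * d\<^sup>2"] by (simp only: real_sqrt_mult real_sqrt_abs) simp
  have se: "sqrt e \<le> sqrt (s / 32) * d"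
    using d real_sqrt_le_mono[of e "s / 32 * d\<^sup>2"] by (simp only: real_sqrt_mult real_sqrt_abs) simp
  have "L * e \<le> L * s / 32 * d\<^sup>2" using mult_left_mono[OF d(2), of L] L(2) by simp
  then have sLe: "sqrt (L * e) \<le> sqrt (L * s / 32) * d"
    using d(1) real_sqrt_le_mono[of "L * e" "L * s / 32 * d\<^sup>2"]
    by (simp only: real_sqrt_mult[of _ "d\<^sup>2"] real_sqrt_abs) simp
  have x: "x \<in> edom \<phi>" using v(1) by (simp add: eps_subdiff_def)
  obtain p \<xi> where p: "p \<in> edom \<phi>" and \<xi>: "\<xi> \<in> limiting_subdiff (\<lambda>z. \<phi> z - \<psi> z) p"
    and px: "norm (p - x) \<le> sqrt (2 * \<delta>)"
    and n\<xi>: "norm \<xi> \<le> (1 + L) * sqrt (2 * \<delta>) + 2 * sqrt (L * e) + L * norm (x - y)"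
    using approximate_limiting_subgradient[OF \<phi> v(1) fin G L v(2)] unfolding \<delta>_def by blast
  have dxp: "dist x p \<le> sqrt (2 * \<delta>)" using px by (simp add: dist_norm norm_minus_commute)
  \<comment> \<open>The minimum serves two purposes: \<open>\<rho>\<close> admits the Lipschitz
    bound between \<open>x\<close> and \<open>p\<close>, and two halves of \<open>r\<close> keep
    \<open>p\<close> within \<open>r\<close> of \<Omega>.\<close>
  then have dxp': "dist x p < min \<rho> (r / 2)" using s\<delta> near(2) by (simp add: d_def)
  have "infdist p \<Omega> \<le> infdist x \<Omega> + dist p x" by (rule infdist_triangle)
  then have "infdist p \<Omega> \<le> r" using near(1) dxp' by (simp add: dist_commute)
  then have Fp: "\<bar>F p - c\<bar> powr \<theta> \<le> C * norm \<xi>" using \<xi> by (rule PL)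
  have "norm \<xi> \<le> (1 + L) * (sqrt (s / 16) * d) + 2 * (sqrt (L * s / 32) * d) + L * d"
    using s\<delta> sLe L(2)
    by (intro order_trans[OF n\<xi>[folded d_def]] add_mono mult_left_mono) auto
  also have "\<dots> = ?B * d" by (simp add: algebra_simps)
  finally have "C * norm \<xi> \<le> C * (?B * d)" using const by (intro mult_left_mono) auto
  then have Fp': "\<bar>F p - c\<bar> powr \<theta> \<le> C * ?B * d" using Fp by (simp add: mult.assoc)
  have B0: "0 \<le> ?B" using L(2) const by simp
  have E0: "0 \<le> ?E" using const by simp
  have "x \<le> 2 * (x + y)" if "0 \<le> x" "0 \<le> y" for x y :: real using that by simp
  note double = this[OF mult_nonneg_nonneg[OF less_imp_le[OF const(3)] B0] E0]
  show ?thesis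
  proof (cases "\<theta> = 0")
    \<comment> \<open>For \<theta> = 0 the step is exact: the tolerance is 0, hence
      \<open>p = x\<close>, and the estimate at \<open>p\<close> is already the one at
      \<open>x\<close>.\<close>
    case True
    then have "\<delta> = 0" by (simp add: \<delta>_def tightened_def)
    then have "p = x" using px by simp
    then have "\<bar>F x - c\<bar> powr \<theta> \<le> C * ?B * d" using Fp' by simp
    also have "\<dots> \<le> 2 * (C * ?B + ?E) * d"
      by (rule mult_right_mono[OF double d(1)])
    finally show ?thesis by (simp only: d_def)
  next
    case False
    then have \<theta>: "0 < \<theta>" using const by simp
    have "\<bar>F x - F p\<bar> \<le> l * dist x p" using lip[OF x p] near(1) dxp' by simp
    also have "\<dots> \<le> l * sqrt (2 * \<delta>)" using dxp const by (intro mult_left_mono) auto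
    finally have "\<bar>F x - F p\<bar> powr \<theta> \<le> (l * sqrt (2 * \<delta>)) powr \<theta>"
      using \<theta> by (intro powr_mono2) auto
    also have "\<dots> = l powr \<theta> * sqrt (2 * \<delta>) powr \<theta>"
      by (rule powr_mult)
    also have "\<dots> \<le> l powr \<theta> * (2 * (sqrt (s / 32) * d))"
      using sqrt_tightened_powr[OF \<theta> const(2) e(1)] se unfolding \<delta>_def by (intro mult_left_mono) auto
    finally have FxFp: "\<bar>F x - F p\<bar> powr \<theta> \<le> ?E * d" by (simp add: mult_ac)
    have "\<bar>F x - c\<bar> powr \<theta> \<le> (\<bar>F p - c\<bar> + \<bar>F x - F p\<bar>) powr \<theta>"
      using \<theta> by (intro powr_mono2) auto
    also have "\<dots> \<le> 2 * (\<bar>F p - c\<bar> powr \<theta> + \<bar>F x - F p\<bar> powr \<theta>)"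
      using const by (intro powr_add_le_double) auto
    also have "\<dots> \<le> 2 * (C * ?B * d + ?E * d)" using Fp' FxFp by simp
    finally show ?thesis by (simp add: d_def algebra_simps)
  qed
qed

section \<open>Cluster points and the recursion along the iterates\<close>

text \<open>A subsequence staying away from the cluster set would itself have a convergent
  subsequence, whose limit belongs to that set.\<close>

lemma infdist_strong_cluster_points_tendsto_0:
  fixes u :: "nat \<Rightarrow> 'a::metric_space"
  assumes "\<forall>s::nat \<Rightarrow> nat. strict_mono s \<longrightarrow> (\<exists>t l. strict_mono t \<and> (u \<circ> s \<circ> t) \<longlonglongrightarrow> l)"
  shows "(\<lambda>k. infdist (u k) (strong_cluster_points u)) \<longlonglongrightarrow> 0"
proof (rule ccontr)
  assume "\<not> ?thesis"
  then obtain e where e: "e > 0" "\<And>N. \<exists>k\<ge>N. e \<le> infdist (u k) (strong_cluster_points u)"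
    by (auto simp: LIMSEQ_def not_less infdist_nonneg)
  then have "infinite {k. e \<le> infdist (u k) (strong_cluster_points u)}"
    by (simp add: infinite_nat_iff_unbounded_le)
  then obtain s :: "nat \<Rightarrow> nat"
    where s: "strict_mono s" "\<And>n. s n \<in> {k. e \<le> infdist (u k) (strong_cluster_points u)}"
    using infinite_enumerate by metis
  obtain t l where t: "strict_mono t" "(u \<circ> s \<circ> t) \<longlonglongrightarrow> l" using assms s(1) by blast
  have "l \<in> strong_cluster_points u"
    unfolding strong_cluster_points_def
    using t strict_mono_o[OF s(1) t(1)] by (auto simp: comp_assoc)
  then have "e \<le> dist ((u \<circ> s \<circ> t) n) l" for n
    using s(2)[of "t n"] infdist_le[of l "strong_cluster_points u" "u (s (t n))"] by simp
  moreover obtain n where "dist ((u \<circ> s \<circ> t) n) l < e"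
    using t(2) e(1) by (auto simp: LIMSEQ_def)
  ultimately show False by (meson leD)
qed

text \<open>Intended for the values of \<open>f\<close>: continuity gives their limit only along a
  subsequence approaching a cluster point, and monotonicity extends it to the whole
  sequence.\<close>

lemma decseq_tendsto_of_subseq:
  fixes a :: "nat \<Rightarrow> real"
  assumes a: "decseq a" and q: "strict_mono q" and lim: "(\<lambda>n. a (q n)) \<longlonglongrightarrow> l"
  shows "a \<longlonglongrightarrow> l" "l \<le> a k"
proof -
  have lower: "l \<le> a k" for k
  proof (rule tendsto_upperbound[OF lim])
    have "a (q n) \<le> a k" if "k \<le> n" for n
      by (rule decseqD[OF a]) (rule order_trans[OF that seq_suble[OF q]])
    then show "\<forall>\<^sub>F n in sequentially. a (q n) \<le> a k"
      by (rule eventually_sequentiallyI)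
  qed simp
  obtain m where m: "a \<longlonglongrightarrow> m" using decseq_convergent[OF a, of l] lower by metis
  have "m = l" using LIMSEQ_unique[OF LIMSEQ_subseq_LIMSEQ[OF m q]] lim by (simp add: comp_def)
  with m lower show "a \<longlonglongrightarrow> l" "l \<le> a k" by auto
qed

lemma C11_funE:
  assumes "C11_fun \<psi>"
  obtains G L where "\<And>z. \<bar>\<psi> z\<bar> \<noteq> \<infinity>" "\<And>z. GDERIV (\<lambda>x. real_of_ereal (\<psi> x)) z :> G z"
    "L-lipschitz_on UNIV G" "0 < L"
proof -
  obtain G L where *: "\<And>z. \<bar>\<psi> z\<bar> \<noteq> \<infinity>" "\<And>z. GDERIV (\<lambda>x. real_of_ereal (\<psi> x)) z :> G z"
    "L-lipschitz_on UNIV G"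
    using assms unfolding C11_fun_def by blast
  \<comment> \<open>The enlarged constant is positive, so that later estimates may divide by
    it.\<close>
  have "(L + 1)-lipschitz_on UNIV G" by (rule lipschitz_on_le[OF *(3)]) simp
  moreover have "0 < L + 1" using lipschitz_on_nonneg[OF *(3)] by simp
  ultimately show thesis using that *(1,2) by blast
qed

lemma eventually_PL_estimate:
  fixes \<phi> \<psi> :: "'a::{real_inner, complete_space} \<Rightarrow> ereal" and F :: "'a \<Rightarrow> real"
    and x y v :: "nat \<Rightarrow> 'a"
  assumes \<phi>: "proper_fun \<phi>" "lsc_fun \<phi>" "convex_fun \<phi>" and \<psi>: "C11_fun \<psi>"
    and PL: "\<And>p \<xi>. \<lbrakk>infdist p \<Omega> \<le> r; \<xi> \<in> limiting_subdiff (\<lambda>z. \<phi> z - \<psi> z) p\<rbrakk>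
      \<Longrightarrow> \<bar>F p - c\<bar> powr \<theta> \<le> C * norm \<xi>"
    and lip: "\<And>x p. \<lbrakk>x \<in> edom \<phi>; p \<in> edom \<phi>; infdist x \<Omega> < \<rho>; dist x p < \<rho>\<rbrakk>
      \<Longrightarrow> \<bar>F x - F p\<bar> \<le> l * dist x p"
    and const: "0 \<le> \<theta>" "\<theta> < 1" "0 < C" "0 < r" "0 < \<rho>" "0 \<le> l" "0 \<le> s"
    and e: "\<And>k. 0 < e k" "\<And>k. e k \<le> 1" "\<And>k. e k \<le> s / 32 * (norm (x k - y k))\<^sup>2"
    and v: "\<And>k. v k \<in> eps_subdiff (tightened \<theta> (e k)) \<phi> (x k)" "\<And>k. v k \<in> eps_subdiff (e k) \<psi> (y k)"
    and x: "(\<lambda>k. infdist (x k) \<Omega>) \<longlonglongrightarrow> 0" and xy: "(\<lambda>k. norm (x k - y k)) \<longlonglongrightarrow> 0"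
  shows "\<exists>K. \<forall>\<^sub>F k in sequentially. \<bar>F (x k) - c\<bar> powr \<theta> \<le> K * norm (x k - y k)"
proof -
  obtain G L where G: "\<And>z. \<bar>\<psi> z\<bar> \<noteq> \<infinity>" "\<And>z. GDERIV (\<lambda>x. real_of_ereal (\<psi> x)) z :> G z"
    "L-lipschitz_on UNIV G" "0 < L"
    using C11_funE[OF \<psi>] by blast
  have m: "0 < min \<rho> (r / 2)" using const by simp
  have "(\<lambda>k. sqrt (s / 16) * norm (x k - y k)) \<longlonglongrightarrow> sqrt (s / 16) * 0"
    using xy by (intro tendsto_intros)
  then have near2: "\<forall>\<^sub>F k in sequentially. sqrt (s / 16) * norm (x k - y k) < min \<rho> (r / 2)"
    by (rule order_tendstoD) (use m in simp)
  have near1: "\<forall>\<^sub>F k in sequentially. infdist (x k) \<Omega> < min \<rho> (r / 2)"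
    using x m by (rule order_tendstoD)
  show ?thesis
    by (rule exI, rule eventually_mono[OF eventually_conj[OF near1 near2]], elim conjE,
        rule PL_estimate_at_trial[OF \<phi> G PL lip const(1,2,3,6,7) e v]; assumption)
qed

lemma adca_generated_descent:
  assumes g: "proper_fun g" "convex_fun g" and h: "proper_fun h" "convex_fun h" "edom h = UNIV"
    and pos: "0 < strong_convexity_modulus g + strong_convexity_modulus h"
    and gen: "adca_generated \<alpha> \<beta> g h \<epsilon> u v w"
    and tol: "\<And>e. \<lbrakk>0 < e; e \<le> 1\<rbrakk> \<Longrightarrow> \<alpha> e \<le> e" "\<And>e. \<lbrakk>0 < e; e \<le> 1\<rbrakk> \<Longrightarrow> \<beta> e \<le> e"
    and F: "\<And>x. x \<in> edom g \<Longrightarrow> g x - h x = ereal (F x)"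
  obtains s where "0 < s" "\<And>k. u k \<in> edom g" "\<And>k. F (w k) \<le> F (u k)"
    "\<And>k. v k \<in> eps_subdiff (\<beta> (\<epsilon> k)) g (u (Suc k))" "\<And>k. v k \<in> eps_subdiff (\<alpha> (\<epsilon> k)) h (w k)"
    "\<And>k. \<epsilon> k \<le> s / 32 * (norm (u (Suc k) - w k))\<^sup>2"
    "\<And>k. F (u (Suc k)) + s / 8 * (norm (u (Suc k) - w k))\<^sup>2 \<le> F (w k)"
proof -
  note final = adca_generated_final[OF gen]
  have hfin: "\<bar>h x\<bar> \<noteq> \<infinity>" for x
    using h(1) UNIV_I[of x] unfolding h(3)[symmetric]
    by (cases "h x") (simp_all add: edom_def proper_fun_def)
  have dom: "x \<in> edom g \<longleftrightarrow> g x - h x < \<infinity>" for x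
    using hfin[of x] by (cases "g x"; cases "h x") (simp_all add: edom_def)
  have Fgh: "F x = real_of_ereal (g x) - real_of_ereal (h x)" if "x \<in> edom g" for x
    using F[OF that] hfin[of x] by (cases "g x"; cases "h x") simp_all
  have vg: "v k \<in> eps_subdiff (\<beta> (\<epsilon> k)) g (u (Suc k))" for k
    by (rule eps_subdiff_of_eps_solution[OF g(1)]) (use final(3)[of k] in \<open>simp add: adca_trial_def\<close>)
  have u: "u k \<in> edom g" for k
  proof (cases k)
    case 0
    then show ?thesis using final(1) dom by simp
  next
    case (Suc n)
    then show ?thesis using vg[of n] by (simp add: eps_subdiff_def)
  qed
  have w: "w k \<in> edom g" for k
    using final(2)[of k] u[of k] unfolding dom by (rule le_less_trans)
  have Fwu: "F (w k) \<le> F (u k)" for k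
    using final(2)[of k] unfolding F[OF w] F[OF u] by simp
  note descent = adca_descent[where a = \<alpha> and b = \<beta> and e = "\<epsilon> k" and w = "w k" and v = "v k"
      and u = "u (Suc k)" for k, OF g h final(3) tol(1)[OF final(5,6)] tol(2)[OF final(5,6)] final(5,4) w]
  \<comment> \<open>One iteration suffices to see that the moduli are finite; their sum is then the
    same \<open>s\<close> for every \<open>k\<close>.\<close>
  obtain s where s: "strong_convexity_modulus g + strong_convexity_modulus h = ereal s"
    by (rule descent[of 0])
  have step: "v k \<in> eps_subdiff (\<alpha> (\<epsilon> k)) h (w k)"
    "\<epsilon> k \<le> s / 32 * (norm (u (Suc k) - w k))\<^sup>2"
    "F (u (Suc k)) + s / 8 * (norm (u (Suc k) - w k))\<^sup>2 \<le> F (w k)" for k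
    unfolding Fgh[OF w] Fgh[OF u] using s by (auto intro: descent[of k])
  show thesis
    by (rule that[of s]) (use pos s u Fwu vg step in auto)
qed

text \<open>Extracts from the algorithm the two real inequalities that determine the rates, with
  \<open>a\<close> the gap of the values and \<open>d\<close> the step lengths. Both smoothness
  cases end in the same form.\<close>

lemma adca_PL_recursion:
  fixes g h f :: "'a::{real_inner, complete_space} \<Rightarrow> ereal"
    and u v w :: "nat \<Rightarrow> 'a"
  assumes g: "proper_fun g" "lsc_fun g" "convex_fun g"
    and h: "proper_fun h" "lsc_fun h" "convex_fun h" and dom_h: "edom h = UNIV"
    and f: "f = (\<lambda>x. g x - h x)"
    and strongly_convex: "strongly_convex_fun g \<or> strongly_convex_fun h"
    and A1: "locally_lipschitz_wrt_dom f" "continuous_on (edom f) f"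
    and \<theta>: "0 \<le> \<theta>" "\<theta> < 1"
    and \<Omega>: "\<Omega> = strong_cluster_points u"
    and A4: "\<forall>s::nat \<Rightarrow> nat. strict_mono s \<longrightarrow> (\<exists>t l. strict_mono t \<and> (u \<circ> s \<circ> t) \<longlonglongrightarrow> l)" "compact \<Omega>"
    and fbar: "f ` \<Omega> = {ereal fbar}"
    and constants: "C > 0" "r > 0"
    and cases:
      "(C11_fun g \<and> adca_generated (tightened \<theta>) id g h eps u v w \<and>
          uniform_PL_estimate f (limiting_subdiff (\<lambda>x. - f x)) \<Omega> fbar \<theta> C r) \<or>
       (C11_fun h \<and> adca_generated id (tightened \<theta>) g h eps u v w \<and>
          uniform_PL_estimate f (limiting_subdiff f) \<Omega> fbar \<theta> C r)"
  obtains a d s K where "\<And>k. f (u k) = ereal (a k + fbar)" "\<And>k. 0 \<le> a k" "a \<longlonglongrightarrow> 0"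
    "\<And>k. 0 \<le> d k" "0 < s" "\<And>k. a (Suc k) + s / 8 * (d k)\<^sup>2 \<le> a k"
    "\<forall>\<^sub>F k in sequentially. a (Suc k) powr \<theta> \<le> K * d k"
proof -
  define F where "F x = real_of_ereal (f x)" for x
  define a where "a k = F (u k) - fbar" for k
  define d where "d k = norm (u (Suc k) - w k)" for k
  have hfin: "\<bar>h x\<bar> \<noteq> \<infinity>" for x
    using h(1) UNIV_I[of x] unfolding dom_h[symmetric]
    by (cases "h x") (simp_all add: edom_def proper_fun_def)
  have "g x - h x < \<infinity> \<longleftrightarrow> g x < \<infinity>" for x
    using hfin[of x] by (cases "g x"; cases "h x") simp_all
  then have dom_f: "edom f = edom g" by (simp add: edom_def f)
  have F: "f x = ereal (F x)" if "x \<in> edom g" for x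
    using that hfin[of x] g(1)
    by (cases "g x"; cases "h x") (simp_all add: F_def f edom_def proper_fun_def)
  \<comment> \<open>Abstract tolerances let the descent and limit arguments run once for both
    variants; the cases separate again only for the subgradient estimate.\<close>
  obtain \<alpha> \<beta> where gen: "adca_generated \<alpha> \<beta> g h eps u v w"
    and cases': "\<alpha> = tightened \<theta> \<and> \<beta> = id \<and> C11_fun g \<and>
        uniform_PL_estimate f (limiting_subdiff (\<lambda>x. - f x)) \<Omega> fbar \<theta> C r \<or>
      \<alpha> = id \<and> \<beta> = tightened \<theta> \<and> C11_fun h \<and>
        uniform_PL_estimate f (limiting_subdiff f) \<Omega> fbar \<theta> C r"
    using cases by (elim disjE conjE) simp_all
  have tol: "\<alpha> e \<le> e" "\<beta> e \<le> e" if "0 < e" "e \<le> 1" for e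
    using cases' tightened_bounds(2)[OF \<theta> that] by (elim disjE conjE; simp)+
  have pos: "0 < strong_convexity_modulus g + strong_convexity_modulus h"
    using strongly_convex strong_convexity_modulus_nonneg[OF g(3)] strong_convexity_modulus_nonneg[OF h(3)]
    unfolding strongly_convex_fun_def
    by (elim disjE) (rule add_pos_nonneg add_nonneg_pos; assumption)+
  note eps = adca_generated_final(5,6)[OF gen]
  obtain s where s0: "0 < s" and u: "\<And>k. u k \<in> edom g" and Fwu: "\<And>k. F (w k) \<le> F (u k)"
    and vg: "\<And>k. v k \<in> eps_subdiff (\<beta> (eps k)) g (u (Suc k))"
    and vh: "\<And>k. v k \<in> eps_subdiff (\<alpha> (eps k)) h (w k)"
    and eps_le: "\<And>k. eps k \<le> s / 32 * (norm (u (Suc k) - w k))\<^sup>2"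
    and Fuw_d: "\<And>k. F (u (Suc k)) + s / 8 * (norm (u (Suc k) - w k))\<^sup>2 \<le> F (w k)"
    using adca_generated_descent[OF g(1,3) h(1,3) dom_h pos gen tol F[unfolded f]] by blast
  have Fuw: "F (u (Suc k)) \<le> F (w k)" for k
    using s0 by (intro order_trans[OF _ Fuw_d]) simp
  have desc: "a (Suc k) + s / 8 * (d k)\<^sup>2 \<le> a k" for k
    using Fuw_d[of k] Fwu[of k] by (simp add: a_def d_def)
  have "a (Suc k) \<le> a k" for k
    using Fuw[of k] Fwu[of k] by (simp add: a_def)
  then have deca: "decseq a" by (rule decseq_SucI)
  have \<Omega>ne: "\<Omega> \<noteq> {}" and \<Omega>f: "\<And>l. l \<in> \<Omega> \<Longrightarrow> f l = ereal fbar" using fbar by auto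
  then have \<Omega>dom: "\<Omega> \<subseteq> edom f" by (auto simp: edom_def)
  obtain l q where l: "l \<in> \<Omega>" and q: "strict_mono q" "(u \<circ> q) \<longlonglongrightarrow> l"
    using \<Omega>ne \<Omega> by (auto simp: strong_cluster_points_def)
  have "(\<lambda>n. f ((u \<circ> q) n)) \<longlonglongrightarrow> f l"
    by (rule continuous_on_tendsto_compose[OF A1(2) q(2)]) (use l \<Omega>dom u dom_f in auto)
  then have "(\<lambda>n. F (u (q n))) \<longlonglongrightarrow> fbar" using \<Omega>f[OF l] by (simp add: F[OF u])
  then have "(\<lambda>n. a (q n)) \<longlonglongrightarrow> fbar - fbar" unfolding a_def by (intro tendsto_intros)
  then have a0: "a \<longlonglongrightarrow> 0" and apos: "\<And>k. 0 \<le> a k"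
    using decseq_tendsto_of_subseq[OF deca q(1)] by auto
  have d2: "(d k)\<^sup>2 \<le> 8 / s * (a k - a (Suc k))" for k
    using desc[of k] s0 by (simp add: field_simps)
  have "(\<lambda>k. (d k)\<^sup>2) \<longlonglongrightarrow> 0"
  proof (rule tendsto_sandwich[where f = "\<lambda>_. 0" and h = "\<lambda>k. 8 / s * (a k - a (Suc k))"])
    have "(\<lambda>k. 8 / s * (a k - a (Suc k))) \<longlonglongrightarrow> 8 / s * (0 - 0)"
      using a0 by (intro tendsto_intros LIMSEQ_Suc)
    then show "(\<lambda>k. 8 / s * (a k - a (Suc k))) \<longlonglongrightarrow> 0" by simp
  qed (use d2 in \<open>simp_all only: zero_le_power2 eventually_True tendsto_const\<close>)
  then have d0: "d \<longlonglongrightarrow> 0" by simp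
  have iu: "(\<lambda>k. infdist (u (Suc k)) \<Omega>) \<longlonglongrightarrow> 0"
    unfolding \<Omega> by (rule LIMSEQ_Suc[OF infdist_strong_cluster_points_tendsto_0[OF A4(1)]])
  \<comment> \<open>The points \<open>w k\<close> also approach \<Omega>, being at distance
    \<open>d k\<close> from the iterates; in the case of smooth \<open>g\<close> the estimate is
    made at them.\<close>
  have iw: "(\<lambda>k. infdist (w k) \<Omega>) \<longlonglongrightarrow> 0"
  proof (rule tendsto_sandwich[where f = "\<lambda>_. 0" and h = "\<lambda>k. infdist (u (Suc k)) \<Omega> + d k"])
    show "\<forall>\<^sub>F k in sequentially. infdist (w k) \<Omega> \<le> infdist (u (Suc k)) \<Omega> + d k"
      using infdist_triangle[of "w k" \<Omega> "u (Suc k)" for k]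
      by (simp add: d_def dist_norm norm_minus_commute)
    show "(\<lambda>k. infdist (u (Suc k)) \<Omega> + d k) \<longlonglongrightarrow> 0" using tendsto_add[OF iu d0] by simp
  qed (auto simp: infdist_nonneg)
  obtain \<rho> lc where \<rho>: "0 < \<rho>" and lc: "0 \<le> lc" and
    lip: "\<And>x y. \<lbrakk>x \<in> edom f; y \<in> edom f; infdist x \<Omega> < \<rho>; dist x y < \<rho>\<rbrakk>
      \<Longrightarrow> \<bar>F x - F y\<bar> \<le> lc * dist x y"
    using locally_lipschitz_near_compact[OF A1(1) A4(2) \<Omega>ne \<Omega>dom] unfolding F_def by metis
  have dpos: "0 \<le> d k" for k by (simp add: d_def)
  have "\<exists>K. \<forall>\<^sub>F k in sequentially. a (Suc k) powr \<theta> \<le> K * d k"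
    using cases'
  proof (elim disjE conjE)
    assume *: "\<alpha> = tightened \<theta>" "\<beta> = id" "C11_fun g"
      and PL: "uniform_PL_estimate f (limiting_subdiff (\<lambda>x. - f x)) \<Omega> fbar \<theta> C r"
    \<comment> \<open>With \<open>g\<close> smooth the tightened step concerns \<open>h\<close> at
      \<open>w k\<close>, so \<open>w k\<close> and \<open>u (Suc k)\<close> take the roles of
      \<open>x\<close> and \<open>y\<close>, and \<open>- f\<close> is the convex-minus-smooth
      difference.\<close>
    have d: "d k = norm (w k - u (Suc k))" for k by (simp add: d_def norm_minus_commute)
    have gfin: "\<bar>g x\<bar> \<noteq> \<infinity>" for x using *(3) by (simp add: C11_fun_def)
    have "g x < \<infinity>" for x using gfin[of x] by (cases "g x") auto
    then have dom: "edom f = edom h" unfolding dom_f dom_h by (simp add: edom_def)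
    have "- f x = h x - g x" for x
      using hfin[of x] gfin[of x] by (cases "g x"; cases "h x") (auto simp: f)
    then have est: "\<bar>F p - fbar\<bar> powr \<theta> \<le> C * norm \<xi>"
      if "infdist p \<Omega> \<le> r" "\<xi> \<in> limiting_subdiff (\<lambda>x. h x - g x) p" for p \<xi>
      using PL that by (simp add: uniform_PL_estimate_def F_def)
    have "\<exists>K. \<forall>\<^sub>F k in sequentially. \<bar>F (w k) - fbar\<bar> powr \<theta> \<le> K * norm (w k - u (Suc k))"
    proof (rule eventually_PL_estimate[where r = r and \<rho> = \<rho>, OF h(1-3) *(3) est lip[unfolded dom]])
      show "eps k \<le> s / 32 * (norm (w k - u (Suc k)))\<^sup>2" for k using eps_le[of k] by (simp only: norm_minus_commute)
      show "v k \<in> eps_subdiff (tightened \<theta> (eps k)) h (w k)" "v k \<in> eps_subdiff (eps k) g (u (Suc k))" for k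
        using vg[of k] vh[of k] * by simp_all
      show "(\<lambda>k. norm (w k - u (Suc k))) \<longlonglongrightarrow> 0" using d0 by (simp only: d[abs_def])
    qed (fact \<theta> constants \<rho> lc less_imp_le[OF s0] eps iw | assumption)+
    then obtain K where K: "\<forall>\<^sub>F k in sequentially. \<bar>F (w k) - fbar\<bar> powr \<theta> \<le> K * d k"
      unfolding d by blast
    \<comment> \<open>Descent passes the estimate from \<open>w k\<close> to the next iterate, whose
      value lies between \<open>fbar\<close> and \<open>F (w k)\<close>.\<close>
    have "a (Suc k) powr \<theta> \<le> \<bar>F (w k) - fbar\<bar> powr \<theta>" for k
      using Fuw[of k] apos[of "Suc k"] \<theta> by (intro powr_mono2) (auto simp: a_def)
    then have "\<forall>\<^sub>F k in sequentially. a (Suc k) powr \<theta> \<le> K * d k"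
      by (intro eventually_mono[OF K]) (rule order_trans)
    then show ?thesis by (rule exI)
  next
    assume *: "\<alpha> = id" "\<beta> = tightened \<theta>" "C11_fun h"
      and PL: "uniform_PL_estimate f (limiting_subdiff f) \<Omega> fbar \<theta> C r"
    have est: "\<bar>F p - fbar\<bar> powr \<theta> \<le> C * norm \<xi>"
      if "infdist p \<Omega> \<le> r" "\<xi> \<in> limiting_subdiff (\<lambda>x. g x - h x) p" for p \<xi>
      using PL that by (simp add: uniform_PL_estimate_def F_def f)
    have "\<exists>K. \<forall>\<^sub>F k in sequentially. \<bar>F (u (Suc k)) - fbar\<bar> powr \<theta> \<le> K * norm (u (Suc k) - w k)"
    proof (rule eventually_PL_estimate[where r = r and \<rho> = \<rho>, OF g *(3) est lip[unfolded dom_f]])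
      show "eps k \<le> s / 32 * (norm (u (Suc k) - w k))\<^sup>2" for k by (rule eps_le)
      show "v k \<in> eps_subdiff (tightened \<theta> (eps k)) g (u (Suc k))" "v k \<in> eps_subdiff (eps k) h (w k)" for k
        using vg[of k] vh[of k] * by simp_all
      show "(\<lambda>k. norm (u (Suc k) - w k)) \<longlonglongrightarrow> 0" using d0 by (simp only: d_def[abs_def])
    qed (fact \<theta> constants \<rho> lc less_imp_le[OF s0] eps iu | assumption)+
    then show ?thesis using apos by (simp add: a_def d_def)
  qed
  then obtain K where K: "\<forall>\<^sub>F k in sequentially. a (Suc k) powr \<theta> \<le> K * d k" by blast
  have fu: "f (u k) = ereal (a k + fbar)" for k by (simp add: F[OF u] a_def)
  show thesis by (rule that[OF fu apos a0 dpos s0 desc K])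
qed

section \<open>Convergence rates of real sequences\<close>

text \<open>Once the terms are below 1, \<open>a (Suc k)\<close> is at most its power with exponent
  \<open>p \<le> 1\<close>, so the inequality becomes linear and can be solved for
  \<open>a (Suc k)\<close>.\<close>

lemma linear_rate_of_powr_decrease:
  fixes a :: "nat \<Rightarrow> real"
  assumes a: "\<And>k. 0 \<le> a k" "a \<longlonglongrightarrow> 0" and p: "p \<le> 1" and M: "0 < M"
    and dec: "\<forall>\<^sub>F k in sequentially. a (Suc k) powr p \<le> M * (a k - a (Suc k))"
  shows "\<exists>q\<in>{0<..<1}. \<forall>\<^sub>F k in sequentially. a (Suc k) \<le> q * a k"
proof (intro bexI)
  have "\<forall>\<^sub>F k in sequentially. a k < 1" using a(2) by (rule order_tendstoD) simp
  then have "\<forall>\<^sub>F k in sequentially. a (Suc k) < 1" by (subst eventually_sequentially_Suc)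
  with dec show "\<forall>\<^sub>F k in sequentially. a (Suc k) \<le> M / (1 + M) * a k"
  proof eventually_elim
    case (elim k)
    have "a (Suc k) = a (Suc k) powr 1" using a(1) by simp
    also have "\<dots> \<le> a (Suc k) powr p"
      using elim a(1)[of "Suc k"] p by (intro powr_mono') auto
    finally have "a (Suc k) \<le> M * (a k - a (Suc k))" using elim by simp
    then show ?case using M by (simp add: field_simps)
  qed
qed (use M in \<open>auto simp: field_simps\<close>)

text \<open>The discrete form of integrating \<open>a' = - a powr p / M\<close>: the power with
  exponent \<open>1 - p\<close> gains a fixed amount per step. If at least half of \<open>a\<close>
  remains, a linearization gives the first term of the minimum; otherwise the power grows by the
  factor \<open>2 powr (p - 1)\<close>, and \<open>a \<le> A\<close> bounds it from below.\<close>

lemma powr_decrease_increment: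
  fixes a b :: real
  assumes ab: "0 < b" "b \<le> a" "a \<le> A" and p: "1 < p" and M: "0 < M"
    and dec: "b powr p \<le> M * (a - b)"
  shows "a powr (1 - p) + min ((p - 1) / M * (1/2) powr p) ((2 powr (p - 1) - 1) * A powr (1 - p))
    \<le> b powr (1 - p)"
proof (cases "a / 2 \<le> b")
  case True
  define x where "x = b / a"
  have x: "0 < x" "b = a * x" "1/2 \<le> x" using ab True by (auto simp: x_def field_simps)
  have a0: "0 < a" using ab by simp
  have "(1/2) powr p \<le> x powr p" using x p by (intro powr_mono2) auto
  also have "\<dots> = b powr p / a powr p" using ab by (simp add: x_def powr_divide)
  also have "\<dots> \<le> M * (a - b) / a powr p" using dec by (intro divide_right_mono) auto
  also have "\<dots> = M * (a powr (1 - p) * (1 - x))"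
    using a0 by (simp add: x(2) powr_diff field_simps)
  finally have "(p - 1) / M * (1/2) powr p \<le> (p - 1) / M * (M * (a powr (1 - p) * (1 - x)))"
    using p M by (intro mult_left_mono) auto
  then have 1: "(p - 1) / M * (1/2) powr p \<le> a powr (1 - p) * ((p - 1) * (1 - x))"
    using M by (simp add: mult_ac)
  \<comment> \<open>Two tangent bounds are chained: \<open>ln x \<le> x - 1\<close>, and
    \<open>1 + y \<le> exp y\<close> at \<open>y = (1 - p) * ln x\<close>.\<close>
  have "(p - 1) * ln x \<le> (p - 1) * (x - 1)"
    using x p by (intro mult_left_mono ln_le_minus_one) auto
  then have "1 + (p - 1) * (1 - x) \<le> 1 + (1 - p) * ln x" by (simp add: algebra_simps)
  also have "\<dots> \<le> x powr (1 - p)" using x by (simp add: powr_def)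
  finally have "a powr (1 - p) * (1 + (p - 1) * (1 - x)) \<le> a powr (1 - p) * x powr (1 - p)"
    by (intro mult_left_mono) auto
  also have "\<dots> = b powr (1 - p)" using x a0 by (simp add: powr_mult)
  finally show ?thesis using 1 by (simp add: algebra_simps)
next
  case False
  have a0: "0 < a" using ab by simp
  have "(2 powr (p - 1) - 1) * A powr (1 - p) \<le> (2 powr (p - 1) - 1) * a powr (1 - p)"
    using ab p a0 by (intro mult_left_mono powr_mono2') (auto simp: ge_one_powr_ge_zero)
  moreover have "2 powr (p - 1) * a powr (1 - p) = (a / 2) powr (1 - p)"
    using a0 by (simp add: powr_divide powr_diff field_simps)
  moreover have "(a / 2) powr (1 - p) \<le> b powr (1 - p)"
    using False ab p by (intro powr_mono2') auto
  ultimately show ?thesis by (simp add: algebra_simps)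
qed

text \<open>Summing the increments makes \<open>a k powr (1 - p)\<close> grow at least linearly; the
  negative exponent \<open>1 / (1 - p)\<close> inverts this into decay.\<close>

lemma sublinear_rate_of_powr_decrease:
  fixes a :: "nat \<Rightarrow> real"
  assumes a: "\<And>k. 0 \<le> a k" and p: "1 < p" and M: "0 < M"
    and dec: "\<forall>\<^sub>F k in sequentially. a (Suc k) powr p \<le> M * (a k - a (Suc k))"
  shows "\<exists>\<eta>>0. \<forall>\<^sub>F k in sequentially. a k \<le> \<eta> * real k powr (1 / (1 - p))"
proof -
  obtain N where N: "\<And>k. N \<le> k \<Longrightarrow> a (Suc k) powr p \<le> M * (a k - a (Suc k))"
    using dec by (auto simp: eventually_sequentially)
  have mono: "a (Suc k) \<le> a k" if "N \<le> k" for k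
  proof -
    have "0 \<le> M * (a k - a (Suc k))" using N[OF that] by (meson order_trans powr_ge_zero)
    then show ?thesis using M by (simp add: zero_le_mult_iff)
  qed
  have anti: "a k \<le> a m" if "N \<le> m" "m \<le> k" for m k
    using that(2,1) by (induction rule: dec_induct) (auto intro: order_trans mono)
  show ?thesis
  \<comment> \<open>Negative powers measure smallness only for positive terms; a vanishing term
    keeps all later ones at zero.\<close>
  proof (cases "\<exists>m\<ge>N. a m = 0")
    case True
    then obtain m where "N \<le> m" "a m = 0" by blast
    then have zero: "a k = 0" if "m \<le> k" for k using anti[of m k] a[of k] that by simp
    have "\<forall>\<^sub>F k in sequentially. a k \<le> 1 * real k powr (1 / (1 - p))"
      using zero by (intro eventually_sequentiallyI[of m]) simp
    then show ?thesis using zero_less_one by blast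
  next
    case False
    then have pos: "0 < a k" if "N \<le> k" for k using a[of k] that by (metis less_eq_real_def)
    define \<mu> where "\<mu> = min ((p - 1) / M * (1/2) powr p) ((2 powr (p - 1) - 1) * a N powr (1 - p))"
    have \<mu>: "\<mu> > 0" using p M pos[of N] by (simp add: \<mu>_def gr_one_powr)
    have incr: "a k powr (1 - p) + \<mu> \<le> a (Suc k) powr (1 - p)" if "N \<le> k" for k
      unfolding \<mu>_def
      by (rule powr_decrease_increment) (use that pos mono anti[of N k] N p M in auto)
    have lower: "\<mu> * real (k - N) \<le> a k powr (1 - p)" if "N \<le> k" for k
      using that
    proof (induction rule: dec_induct)
      case (step k)
      then show ?case using incr[of k] by (simp add: Suc_diff_le algebra_simps)
    qed simp
    \<comment> \<open>From \<open>2 * N + 1\<close> on, \<open>k - N\<close> is at least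
      \<open>k / 2\<close> and \<open>k\<close> is positive, which the reversed monotonicity of
      negative powers requires.\<close>
    have "a k \<le> (\<mu> / 2) powr (1 / (1 - p)) * real k powr (1 / (1 - p))" if k: "2 * N + 1 \<le> k" for k
    proof -
      have "\<mu> * (real k / 2) \<le> \<mu> * real (k - N)" using k \<mu> by (intro mult_left_mono) auto
      also have "\<dots> \<le> a k powr (1 - p)" using k by (intro lower) auto
      finally have "(a k powr (1 - p)) powr (1 / (1 - p)) \<le> (\<mu> * (real k / 2)) powr (1 / (1 - p))"
        using k \<mu> p by (intro powr_mono2') (auto simp: field_simps)
      then show ?thesis using k p pos[of k] \<mu> by (simp add: powr_powr flip: powr_mult)
    qed
    then show ?thesis using \<mu>
      by (intro exI[of _ "(\<mu> / 2) powr (1 / (1 - p))"]) (auto simp: eventually_sequentially)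
  qed
qed

lemma rates_of_PL_decrease:
  fixes a d :: "nat \<Rightarrow> real"
  assumes a: "\<And>k. 0 \<le> a k" "a \<longlonglongrightarrow> 0" and d: "\<And>k. 0 \<le> d k" and s: "0 < s"
    and descent: "\<And>k. a (Suc k) + s / 8 * (d k)\<^sup>2 \<le> a k"
    and PL: "\<forall>\<^sub>F k in sequentially. a (Suc k) powr \<theta> \<le> K * d k"
  shows "\<theta> = 0 \<Longrightarrow> \<forall>\<^sub>F k in sequentially. a k = 0"
    "\<theta> \<le> 1 / 2 \<Longrightarrow> \<exists>q\<in>{0<..<1}. \<forall>\<^sub>F k in sequentially. a (Suc k) \<le> q * a k"
    "1 / 2 < \<theta> \<Longrightarrow> \<exists>\<eta>>0. \<forall>\<^sub>F k in sequentially. a k \<le> \<eta> * real k powr (1 / (1 - 2 * \<theta>))"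
proof -
  \<comment> \<open>The factor from squaring the estimate and inserting the descent bound on
    \<open>(d k)\<^sup>2\<close>; the added 1 makes it positive even when
    \<open>K = 0\<close>.\<close>
  define M where "M = K\<^sup>2 * (8 / s) + 1"
  have M: "0 < M" using s by (simp add: M_def add_nonneg_pos)
  have d2: "(d k)\<^sup>2 \<le> 8 / s * (a k - a (Suc k))" for k
    using descent[of k] s by (simp add: field_simps)
  have dec: "\<forall>\<^sub>F k in sequentially. a (Suc k) powr (2 * \<theta>) \<le> M * (a k - a (Suc k))"
    using PL
  proof eventually_elim
    case (elim k)
    have "0 \<le> s / 8 * (d k)\<^sup>2" using s by simp
    then have diff: "0 \<le> a k - a (Suc k)" using descent[of k] by linarith
    have "a (Suc k) powr (2 * \<theta>) = (a (Suc k) powr \<theta>)\<^sup>2"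
      by (simp add: power2_eq_square flip: powr_add)
    also have "\<dots> \<le> (K * d k)\<^sup>2" using elim by (intro power_mono) auto
    also have "\<dots> \<le> K\<^sup>2 * (8 / s * (a k - a (Suc k)))"
      using d2[of k] by (simp only: power_mult_distrib) (intro mult_left_mono, auto)
    also have "\<dots> \<le> M * (a k - a (Suc k))" using diff by (simp add: M_def algebra_simps)
    finally show ?case .
  qed
  show "\<exists>q\<in>{0<..<1}. \<forall>\<^sub>F k in sequentially. a (Suc k) \<le> q * a k" if "\<theta> \<le> 1 / 2"
    by (rule linear_rate_of_powr_decrease[OF a _ M dec]) (use that in simp)
  show "\<exists>\<eta>>0. \<forall>\<^sub>F k in sequentially. a k \<le> \<eta> * real k powr (1 / (1 - 2 * \<theta>))" if "1 / 2 < \<theta>"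
    by (rule sublinear_rate_of_powr_decrease[OF a(1) _ M dec]) (use that in simp)
  \<comment> \<open>By the convention for \<open>0 powr 0\<close> the left side of the recursion is
    1 or 0 according to whether \<open>a (Suc k)\<close> is nonzero, while the right side tends to
    0.\<close>
  show "\<forall>\<^sub>F k in sequentially. a k = 0" if \<theta>: "\<theta> = 0"
  proof -
    have "(\<lambda>k. M * (a k - a (Suc k))) \<longlonglongrightarrow> M * (0 - 0)"
      using a(2) by (intro tendsto_intros LIMSEQ_Suc)
    then have "\<forall>\<^sub>F k in sequentially. M * (a k - a (Suc k)) < 1"
      by (rule order_tendstoD) simp
    with dec have "\<forall>\<^sub>F k in sequentially. a (Suc k) = 0"
      by eventually_elim (rule ccontr, simp add: \<theta>)
    then show ?thesis by (subst (asm) eventually_sequentially_Suc)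
  qed
qed

theorem theorem4p4:
  fixes g h f :: "'a::{real_inner, complete_space} \<Rightarrow> ereal"
    and u v w :: "nat \<Rightarrow> 'a"
    and eps :: "nat \<Rightarrow> real"
    and \<Omega> :: "'a set"
    and \<theta> C r fbar :: real
  assumes g: "proper_fun g" "lsc_fun g" "convex_fun g"
    and h: "proper_fun h" "lsc_fun h" "convex_fun h" "continuous_on UNIV h"
    and f: "f = (\<lambda>x. g x - h x)" "lsc_fun f"
    and dom_h: "edom h = UNIV"
    and h_bounded: "\<forall>B. bounded B \<longrightarrow> (\<exists>M::real. \<forall>x\<in>B. \<bar>h x\<bar> \<le> ereal M)"
    and f_bounded_below: "(INF x. f x) > -\<infinity>"
    and strongly_convex: "strongly_convex_fun g \<or> strongly_convex_fun h"
    and A1: "locally_lipschitz_wrt_dom f" "PL_property f"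
    and \<theta>: "0 \<le> \<theta>" "\<theta> < 1"
    and not_critical: "\<forall>k. \<not> critical_point g h (w k)"
    and u_bounded: "bounded (range u)"
    and \<Omega>: "\<Omega> = strong_cluster_points u"
    and A4: "\<forall>s::nat \<Rightarrow> nat. strict_mono s \<longrightarrow> (\<exists>t l. strict_mono t \<and> (u \<circ> s \<circ> t) \<longlonglongrightarrow> l)" "compact \<Omega>"
    and fbar: "f ` \<Omega> = {ereal fbar}"
    and constants: "C > 0" "r > 0"
    and cases:
      "(C11_fun g \<and> adca_generated (tightened \<theta>) id g h eps u v w \<and>
          uniform_PL_estimate f (limiting_subdiff (\<lambda>x. - f x)) \<Omega> fbar \<theta> C r) \<or>
       (C11_fun h \<and> adca_generated id (tightened \<theta>) g h eps u v w \<and>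
          uniform_PL_estimate f (limiting_subdiff f) \<Omega> fbar \<theta> C r)"
  shows "(\<theta> = 0 \<longrightarrow> (\<forall>\<^sub>F k in sequentially. f (u k) = ereal fbar)) \<and>
    (\<theta> \<in> {0<..1/2} \<longrightarrow> (\<exists>q\<in>{0<..<1::real}. \<forall>\<^sub>F k in sequentially.
        f (u (Suc k)) - ereal fbar \<le> ereal q * (f (u k) - ereal fbar))) \<and>
    (\<theta> \<in> {1/2<..<1} \<longrightarrow> (\<exists>\<eta>>0. \<forall>\<^sub>F k in sequentially.
        f (u k) - ereal fbar \<le> ereal (\<eta> * real k powr (1 / (1 - 2 * \<theta>)))))"
proof -
  have cont: "continuous_on (edom f) f" using A1(2) by (simp add: PL_property_def)
  obtain a d s K where fu: "\<And>k. f (u k) = ereal (a k + fbar)"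
    and *: "\<And>k. 0 \<le> a k" "a \<longlonglongrightarrow> 0" "\<And>k. 0 \<le> d k" "0 < s"
      "\<And>k. a (Suc k) + s / 8 * (d k)\<^sup>2 \<le> a k" "\<forall>\<^sub>F k in sequentially. a (Suc k) powr \<theta> \<le> K * d k"
    using adca_PL_recursion[OF g h(1-3) dom_h f(1) strongly_convex A1(1) cont \<theta> \<Omega> A4 fbar constants cases]
    by blast
  show ?thesis using rates_of_PL_decrease[OF *] unfolding fu by simp
qed

end
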